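(* Let $\mathcal{X}$ be a set, $n\ge 1$, $f:\mathcal{X}^n\to\mathbb{R}$, let $s,t>0$ and $\sigma\ge\sqrt2$, with $S_f^t(x)<\infty$ for all $x\in\mathcal{X}^n$. Let $Z$ be distributed as $\mathsf{ULN}(\sigma)$. Then the randomized algorithm $M:\mathcal{X}^n\to\mathbb{R}$ given by $$M(x)=f(x)+\frac1s\cdot S_f^t(x)\cdot Z$$ is $\frac12\varepsilon^2$-CDP for $\varepsilon=\frac{t}{\sigma}+e^{3\sigma^2/2}\cdot\sqrt{\frac{2}{\pi\sigma^2}}\cdot s$.
   Context: $\mathsf{ULN}(\sigma)$ (uniform log-normal), $\sigma>0$, is the distribution of $U e^{\sigma Y}$ where $U$ is uniform on $[-1,1]$, $Y$ is standard Gaussian, and $U,Y$ are independent. For $x,y\in\mathcal{X}^n$, $d(x,y)$ is the number of entries in which they differ; $x,y$ are neighboring if $d(x,y)\le1$. The local sensitivity is $\mathsf{LS}_f(x)=\sup_{y:d(x,y)\le1}|f(y)-f(x)|$, and the $t$-smoothed sensitivity is $S_f^t(x)=\sup_{y\in\mathcal{X}^n}e^{-t\,d(x,y)}\,\mathsf{LS}_f(y)$. For $\alpha\in(1,\infty)$ the Rényi divergence is $D_\alpha(P\|Q)=\frac{1}{\alpha-1}\log\mathbb{E}_{X\leftarrow P}\left[(P(X)/Q(X))^{\alpha-1}\right]$ (ratio of densities, $+\infty$ if $P$ is not absolutely continuous with respect to $Q$); $D_\alpha$ of random variables means $D_\alpha$ of their distributions. A randomized algorithm $M$ on $\mathcal{X}^n$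 is $\frac12\varepsilon^2$-CDP if $D_\alpha(M(x)\|M(y))\le\frac12\varepsilon^2\alpha$ for all neighboring $x,y\in\mathcal{X}^n$ and all $\alpha\in(1,\infty)$. *)

theory Defs
  imports "HOL-Probability.Probability" "HOL-Library.NList"
begin

text \<open>
  A data set in \<open>X\<^sup>n\<close> is an element of \<^term>\<open>nlists n X\<close>, i.e. a list of length \<open>n\<close> with all
  entries in \<open>X\<close>. A randomized algorithm is given by the map sending each data set to its
  output distribution.
\<close>

definition ULN :: "real \<Rightarrow> real measure" where
  "ULN \<sigma> = distr (uniform_measure lborel {-1..1} \<Otimes>\<^sub>M density lborel std_normal_density) borel
              (\<lambda>(u, y). u * exp (\<sigma> * y))"

(* Only used for lists of equal length. *)
definition hamming_dist :: "'a list \<Rightarrow> 'a list \<Rightarrow> nat" where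
  "hamming_dist x y = card {i. i < length x \<and> x ! i \<noteq> y ! i}"

definition local_sensitivity :: "nat \<Rightarrow> 'a set \<Rightarrow> ('a list \<Rightarrow> real) \<Rightarrow> 'a list \<Rightarrow> ereal" where
  "local_sensitivity n X f x =
     (SUP y\<in>{y \<in> nlists n X. hamming_dist x y \<le> 1}. ereal \<bar>f y - f x\<bar>)"

definition smooth_sensitivity ::
    "nat \<Rightarrow> 'a set \<Rightarrow> ('a list \<Rightarrow> real) \<Rightarrow> real \<Rightarrow> 'a list \<Rightarrow> ereal" where
  "smooth_sensitivity n X f t x =
     (SUP y\<in>nlists n X. ereal (exp (- t * real (hamming_dist x y))) * local_sensitivity n X f y)"

text \<open>
  In the Renyi divergence the density ratio \<open>P(x)/Q(x)\<close> is the Radon-Nikodym derivative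
  \<open>dP/dQ = RN_deriv Q P\<close>, which also covers distributions without a Lebesgue density.
  The assertion \<open>P << Q\<close> reads \<^term>\<open>absolutely_continuous Q P\<close> in the library's argument order.
  For probability measures \<open>P << Q\<close> the expectation below is positive, so \<^term>\<open>ln\<close> is not
  applied at \<open>0\<close>; it may be infinite, which is why that case is separate.
\<close>

definition renyi_divergence :: "real \<Rightarrow> 'b measure \<Rightarrow> 'b measure \<Rightarrow> ereal" where
  "renyi_divergence \<alpha> P Q =
     (let E = (\<integral>\<^sup>+ x. ennreal (enn2real (RN_deriv Q P x) powr (\<alpha> - 1)) \<partial>P) in
      if \<not> absolutely_continuous Q P \<or> E = \<infinity> then \<infinity>
      else ereal (1 / (\<alpha> - 1) * ln (enn2real E)))"

definition CDP :: "real \<Rightarrow> nat \<Rightarrow> 'a set \<Rightarrow> ('a list \<Rightarrow> 'b measure) \<Rightarrow> bool" where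
  "CDP \<rho> n X M \<longleftrightarrow>
     (\<forall>x\<in>nlists n X. \<forall>y\<in>nlists n X. hamming_dist x y \<le> 1 \<longrightarrow>
        (\<forall>\<alpha>>1. renyi_divergence \<alpha> (M x) (M y) \<le> ereal (\<rho> * \<alpha>)))"

end

theory Submission
  imports Defs
begin

text \<open>
  For neighbouring data sets \<open>x, y\<close> the smooth sensitivities differ by a factor of at most
  \<open>exp t\<close>, while \<open>\<bar>f x - f y\<bar>\<close> is at most the smooth sensitivity of either. If these are
  positive, then up to an affine change of variable one compares \<open>Z\<close> with
  \<open>exp \<tau> * Z + d\<close>, where \<open>\<bar>\<tau>\<bar> \<le> t\<close> and \<open>\<bar>d\<bar> \<le> s * exp \<tau>\<close>;
  if one vanishes, both outputs are the same constant. The scaling and the translation are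
  treated separately.

  Scaling. Since \<open>Z = U * exp (\<sigma> * Y)\<close>, scaling by \<open>exp \<tau>\<close> amounts to shifting the Gaussian variable
  \<open>\<sigma> * Y\<close> by \<open>\<tau>\<close>. By the data processing inequality (\<open>renyi_integral_mixture_le\<close>) the divergence is
  at most that of the two Gaussians, which is \<open>(\<tau> / \<sigma>)\<^sup>2 / 2 * \<alpha>\<close>
  (\<open>renyi_integral_normal_shift\<close>).

  Translation. The density of \<open>Z\<close> at \<open>x\<close> is a multiple of the Gaussian tail at
  \<open>(ln \<bar>x\<bar> + \<sigma>\<^sup>2) / \<sigma>\<close>, and an elementary tail estimate bounds its logarithmic derivative by
  \<open>K = exp (3 * \<sigma>\<^sup>2 / 2) * sqrt (2 / (pi * \<sigma>\<^sup>2))\<close> (\<open>uln_density_ratio\<close>). Translation of \<open>Z\<close> by at most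
  \<open>s\<close> therefore changes the log-density by at most \<open>K * s\<close> almost everywhere, and such a bound
  gives divergence at most \<open>(K * s)\<^sup>2 / 2 * \<alpha>\<close> (\<open>renyi_integral_le_of_bounded_ratio\<close>).

  Composition. Bounds \<open>a\<^sup>2 / 2 * \<alpha>\<close> and \<open>b\<^sup>2 / 2 * \<alpha>\<close>, each valid for all orders, combine to
  \<open>(a + b)\<^sup>2 / 2 * \<alpha>\<close> by Hoelder's inequality (\<open>renyi_integral_triangle\<close>). With
  \<open>a = t / \<sigma>\<close> and \<open>b = K * s\<close> this is the claim.
\<close>

section \<open>Renyi divergence of distributions with densities\<close>

text \<open>
  The moment \<open>exp ((\<alpha> - 1) * D\<^sub>\<alpha>(p \<parallel> q))\<close>, for densities with respect to a common base
  measure. Unlike the divergence it is a plain integral, so that Tonelli's theorem, convexity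
  and substitution apply to it directly; the densities are real-valued and will be
  strictly positive, which keeps \<open>powr\<close> well behaved.
\<close>
definition renyi_integral :: "real \<Rightarrow> 'b measure \<Rightarrow> ('b \<Rightarrow> real) \<Rightarrow> ('b \<Rightarrow> real) \<Rightarrow> ennreal" where
  "renyi_integral \<alpha> N p q = (\<integral>\<^sup>+x. ennreal (p x powr \<alpha> * q x powr (1 - \<alpha>)) \<partial>N)"

text \<open>
  The Radon-Nikodym derivative of \<open>p N\<close> with respect to \<open>q N\<close> is \<open>p / q\<close> almost everywhere,
  and \<open>(p / q)\<^bsup>\<alpha> - 1\<^esup> p = p\<^bsup>\<alpha>\<^esup> q\<^bsup>1 - \<alpha>\<^esup>\<close>.
\<close>
lemma renyi_divergence_density_le:
  assumes [measurable]: "p \<in> borel_measurable N" "q \<in> borel_measurable N"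
    and pos: "\<And>x. 0 < p x" "\<And>x. 0 < q x"
    and Q: "prob_space (density N q)"
    and "\<alpha> > 1" and "0 \<le> c"
    and I: "renyi_integral \<alpha> N p q \<le> ennreal (exp ((\<alpha> - 1) * c))"
  shows "renyi_divergence \<alpha> (density N p) (density N q) \<le> ereal c"
proof -
  let ?P = "density N p" and ?Q = "density N q"
  interpret Q: prob_space ?Q by (fact Q)
  have P: "density ?Q (\<lambda>x. ennreal (p x / q x)) = ?P"
    by (subst density_density_eq)
       (auto intro!: density_cong AE_I2 simp flip: ennreal_mult simp: pos less_imp_le less_imp_neq[OF pos(2), symmetric])
  have ac: "absolutely_continuous ?Q ?P"
    unfolding P[symmetric] by (rule absolutely_continuousI_density) simp
  have "AE x in ?Q. ennreal (p x / q x) = RN_deriv ?Q ?P x"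
    by (rule Q.RN_deriv_unique[OF _ P]) simp
  then have "AE x in ?P. ennreal (p x / q x) = RN_deriv ?Q ?P x"
    by (intro absolutely_continuous_AE[OF _ ac]) auto
  then have "(\<integral>\<^sup>+x. ennreal (enn2real (RN_deriv ?Q ?P x) powr (\<alpha> - 1)) \<partial>?P)
      = (\<integral>\<^sup>+x. ennreal ((p x / q x) powr (\<alpha> - 1)) \<partial>?P)"
  proof (intro nn_integral_cong_AE, eventually_elim)
    fix x assume "ennreal (p x / q x) = RN_deriv ?Q ?P x"
    then have "enn2real (RN_deriv ?Q ?P x) = p x / q x"
      using pos[of x] by (metis divide_nonneg_nonneg enn2real_ennreal less_imp_le)
    then show "ennreal (enn2real (RN_deriv ?Q ?P x) powr (\<alpha> - 1)) = ennreal ((p x / q x) powr (\<alpha> - 1))"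
      by simp
  qed
  also have "\<dots> = renyi_integral \<alpha> N p q"
    unfolding renyi_integral_def
    by (subst nn_integral_density)
       (auto intro!: nn_integral_cong simp: pos less_imp_le powr_divide powr_diff powr_minus_divide field_simps
         simp flip: ennreal_mult)
  finally have E: "(\<integral>\<^sup>+x. ennreal (enn2real (RN_deriv ?Q ?P x) powr (\<alpha> - 1)) \<partial>?P)
      = renyi_integral \<alpha> N p q" .
  let ?E = "renyi_integral \<alpha> N p q"
  have fin: "?E \<noteq> \<infinity>" using I by (auto simp: top_unique)
  have "ln (enn2real ?E) \<le> (\<alpha> - 1) * c"
  proof (cases "enn2real ?E = 0")
    case False
    then have "0 < enn2real ?E" by (simp add: less_le)
    moreover have "enn2real ?E \<le> exp ((\<alpha> - 1) * c)"
      using enn2real_mono[OF I] by simp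
    ultimately show ?thesis by (metis ln_exp ln_le_cancel_iff exp_gt_zero)
  qed (use assms in simp)
  then show ?thesis
    using ac fin \<open>\<alpha> > 1\<close> unfolding renyi_divergence_def Let_def E by (simp add: field_simps)
qed

text \<open>
  Needed when the smooth sensitivity vanishes: both outputs are then the same point mass, which
  has no Lebesgue density. The distribution itself serves as the base measure.
\<close>
lemma renyi_divergence_self:
  assumes "prob_space P" and \<alpha>: "1 < \<alpha>" and c: "0 \<le> c"
  shows "renyi_divergence \<alpha> P P \<le> ereal c"
  using renyi_divergence_density_le[of "\<lambda>_. 1" P "\<lambda>_. 1" \<alpha> c] assms
  by (simp add: renyi_integral_def density_1 prob_space.emeasure_space_1)

text \<open>
  Hoelder's inequality, in the form that only asks for upper bounds on the two integrals: after
  dividing by the bounds, integrate the weighted arithmetic-geometric mean inequality.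
\<close>
lemma nn_integral_powr_Hoelder:
  fixes f g :: "'b \<Rightarrow> real"
  assumes [measurable]: "f \<in> borel_measurable N" "g \<in> borel_measurable N"
    and pos: "\<And>x. 0 \<le> f x" "\<And>x. 0 \<le> g x"
    and f: "(\<integral>\<^sup>+x. f x \<partial>N) \<le> ennreal A" and g: "(\<integral>\<^sup>+x. g x \<partial>N) \<le> ennreal B"
    and A: "0 < A" and B: "0 < B" and \<theta>: "0 < \<theta>" "\<theta> < 1"
  shows "(\<integral>\<^sup>+x. ennreal (f x powr \<theta> * g x powr (1 - \<theta>)) \<partial>N) \<le> ennreal (A powr \<theta> * B powr (1 - \<theta>))"
proof -
  have "(\<integral>\<^sup>+x. ennreal (f x powr \<theta> * g x powr (1 - \<theta>)) \<partial>N)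
    = (\<integral>\<^sup>+x. ennreal (A powr \<theta> * B powr (1 - \<theta>)) *
        ennreal ((f x / A) powr \<theta> * (g x / B) powr (1 - \<theta>)) \<partial>N)"
    using A B pos by (intro nn_integral_cong) (simp flip: ennreal_mult add: powr_divide)
  also have "\<dots> = ennreal (A powr \<theta> * B powr (1 - \<theta>)) *
      (\<integral>\<^sup>+x. ennreal ((f x / A) powr \<theta> * (g x / B) powr (1 - \<theta>)) \<partial>N)"
    by (rule nn_integral_cmult) measurable
  also have "(\<integral>\<^sup>+x. ennreal ((f x / A) powr \<theta> * (g x / B) powr (1 - \<theta>)) \<partial>N)
    \<le> (\<integral>\<^sup>+x. ennreal (\<theta> / A) * f x + ennreal ((1 - \<theta>) / B) * g x \<partial>N)"
  proof (intro nn_integral_mono)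
    fix x
    have "(f x / A) powr \<theta> * (g x / B) powr (1 - \<theta>) \<le> \<theta> * (f x / A) + (1 - \<theta>) * (g x / B)"
    proof (cases "f x = 0 \<or> g x = 0")
      case False
      then show ?thesis
        using \<theta> pos[of x] A B by (intro Youngs_inequality_0) (auto simp: less_le)
    qed (use \<theta> pos[of x] A B in auto)
    then show "ennreal ((f x / A) powr \<theta> * (g x / B) powr (1 - \<theta>))
      \<le> ennreal (\<theta> / A) * f x + ennreal ((1 - \<theta>) / B) * g x"
      using pos[of x] A B \<theta> by (simp flip: ennreal_mult ennreal_plus add: ennreal_leI)
  qed
  also have "\<dots> = ennreal (\<theta> / A) * (\<integral>\<^sup>+x. f x \<partial>N) + ennreal ((1 - \<theta>) / B) * (\<integral>\<^sup>+x. g x \<partial>N)"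
    by (subst nn_integral_add) (auto simp: nn_integral_cmult)
  also have "\<dots> \<le> ennreal (\<theta> / A) * ennreal A + ennreal ((1 - \<theta>) / B) * ennreal B"
    by (intro add_mono mult_left_mono f g) auto
  also have "\<dots> = 1"
    using A B \<theta> by (simp flip: ennreal_mult ennreal_plus)
  finally show ?thesis by (simp add: mult_left_mono)
qed

text \<open>
  Concentrated divergence obeys a triangle inequality on the scale of \<open>\<epsilon>\<close>. For any
  \<open>0 < \<theta> < 1\<close>, the integrand factors as
  \<open>p\<^bsup>\<alpha>\<^esup> r\<^bsup>1 - \<alpha>\<^esup> = (p\<^bsup>\<beta>\<^esup> q\<^bsup>1 - \<beta>\<^esup>)\<^bsup>\<theta>\<^esup> (q\<^bsup>\<gamma>\<^esup> r\<^bsup>1 - \<gamma>\<^esup>)\<^bsup>1 - \<theta>\<^esup>\<close> with \<open>\<beta> = \<alpha> / \<theta>\<close> and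
  \<open>\<gamma> = 1 + (\<alpha> - 1) / (1 - \<theta>)\<close>, since the exponents of \<open>q\<close> then cancel, and Hoelder's inequality
  bounds the integral by the two given moments. The hypotheses are used at orders \<open>\<beta>\<close> and \<open>\<gamma>\<close>
  different from \<open>\<alpha>\<close>, which is why they range over all orders.
\<close>
lemma renyi_integral_triangle:
  assumes [measurable]: "p \<in> borel_measurable N" "q \<in> borel_measurable N" "r \<in> borel_measurable N"
    and pos: "\<And>x. 0 < p x" "\<And>x. 0 < q x" "\<And>x. 0 < r x"
    and a: "0 < a" and b: "0 < b"
    and pq: "\<And>\<beta>. \<beta> > 1 \<Longrightarrow> renyi_integral \<beta> N p q \<le> ennreal (exp ((\<beta> - 1) * (a\<^sup>2 / 2 * \<beta>)))"
    and qr: "\<And>\<beta>. \<beta> > 1 \<Longrightarrow> renyi_integral \<beta> N q r \<le> ennreal (exp ((\<beta> - 1) * (b\<^sup>2 / 2 * \<beta>)))"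
    and \<alpha>: "\<alpha> > 1"
  shows "renyi_integral \<alpha> N p r \<le> ennreal (exp ((\<alpha> - 1) * ((a + b)\<^sup>2 / 2 * \<alpha>)))"
proof -
  \<comment> \<open>This weight minimises the resulting exponent; with it the two contributions are
      \<open>\<alpha> (\<alpha> - 1) (a + b) a / 2\<close> and \<open>\<alpha> (\<alpha> - 1) (a + b) b / 2\<close>.\<close>
  define D where "D = \<alpha> * a + (\<alpha> - 1) * b"
  define \<theta> where "\<theta> = \<alpha> * a / D"
  define \<beta> where "\<beta> = D / a"
  define \<gamma> where "\<gamma> = 1 + D / b"
  have D: "D > 0" "D > a"
  proof -
    have "1 * a < \<alpha> * a" "0 < (\<alpha> - 1) * b" using \<alpha> a b by (auto intro: mult_strict_right_mono)
    then show "D > 0" "D > a" using a unfolding D_def by linarith+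
  qed
  have \<theta>: "0 < \<theta>" "\<theta> < 1" "1 - \<theta> = (\<alpha> - 1) * b / D"
    using \<alpha> a b D by (auto simp: \<theta>_def field_simps) (auto simp: D_def field_simps)
  have \<beta>\<gamma>: "\<beta> > 1" "\<gamma> > 1" using D a b by (auto simp: \<beta>_def \<gamma>_def)
  have e1: "\<beta> * \<theta> = \<alpha>" using a D by (simp add: \<beta>_def \<theta>_def)
  have e2: "(1 - \<gamma>) * (1 - \<theta>) = 1 - \<alpha>" using b D unfolding \<theta>(3) by (simp add: \<gamma>_def field_simps)
  have e3: "(1 - \<beta>) * \<theta> + \<gamma> * (1 - \<theta>) = 0" using e1 e2 by (simp add: algebra_simps)
  have "renyi_integral \<alpha> N p r = (\<integral>\<^sup>+x. ennreal ((p x powr \<beta> * q x powr (1 - \<beta>)) powr \<theta>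
      * (q x powr \<gamma> * r x powr (1 - \<gamma>)) powr (1 - \<theta>)) \<partial>N)"
    unfolding renyi_integral_def
  proof (intro nn_integral_cong arg_cong[of _ _ ennreal])
    fix x
    have "(p x powr \<beta> * q x powr (1 - \<beta>)) powr \<theta> * (q x powr \<gamma> * r x powr (1 - \<gamma>)) powr (1 - \<theta>)
      = p x powr (\<beta> * \<theta>) * q x powr ((1 - \<beta>) * \<theta> + \<gamma> * (1 - \<theta>)) * r x powr ((1 - \<gamma>) * (1 - \<theta>))"
      by (simp add: powr_mult powr_powr powr_add)
    then show "p x powr \<alpha> * r x powr (1 - \<alpha>) = (p x powr \<beta> * q x powr (1 - \<beta>)) powr \<theta>
      * (q x powr \<gamma> * r x powr (1 - \<gamma>)) powr (1 - \<theta>)"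
      using pos(2)[of x] unfolding e1 e2 e3 by simp
  qed
  also have "\<dots> \<le> ennreal (exp ((\<beta> - 1) * (a\<^sup>2 / 2 * \<beta>)) powr \<theta>
      * exp ((\<gamma> - 1) * (b\<^sup>2 / 2 * \<gamma>)) powr (1 - \<theta>))"
    using pq[OF \<beta>\<gamma>(1)] qr[OF \<beta>\<gamma>(2)] \<theta> unfolding renyi_integral_def
    by (intro nn_integral_powr_Hoelder) auto
  also have "exp ((\<beta> - 1) * (a\<^sup>2 / 2 * \<beta>)) powr \<theta> * exp ((\<gamma> - 1) * (b\<^sup>2 / 2 * \<gamma>)) powr (1 - \<theta>)
    = exp (((\<beta> - 1) * (a\<^sup>2 / 2 * \<beta>)) * \<theta> + ((\<gamma> - 1) * (b\<^sup>2 / 2 * \<gamma>)) * (1 - \<theta>))"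
    by (simp add: exp_powr_real exp_add)
  also have "((\<beta> - 1) * (a\<^sup>2 / 2 * \<beta>)) * \<theta> + ((\<gamma> - 1) * (b\<^sup>2 / 2 * \<gamma>)) * (1 - \<theta>)
     = (\<beta> - 1) * (a\<^sup>2 / 2) * (\<beta> * \<theta>) + \<gamma> * (b\<^sup>2 / 2) * - ((1 - \<gamma>) * (1 - \<theta>))"
    by (simp add: algebra_simps)
  also have "\<dots> = (\<alpha> - 1) * ((a + b)\<^sup>2 / 2 * \<alpha>)"
    unfolding e1 e2 unfolding \<beta>_def \<gamma>_def D_def using a b by (simp add: field_simps power2_eq_square)
  finally show ?thesis .
qed

section \<open>Densities with bounded ratio\<close>

text \<open>
  The function \<open>ln (cosh x) - x\<^sup>2 / 2\<close> is decreasing on the nonnegative reals, because its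
  derivative is \<open>tanh x - x \<le> 0\<close>.
\<close>
lemma cosh_le_exp_cosh:
  fixes u v :: real
  assumes "0 \<le> u" "u \<le> v"
  shows "cosh v \<le> exp ((v\<^sup>2 - u\<^sup>2) / 2) * cosh u"
proof -
  have "cosh v * exp (- v\<^sup>2 / 2) \<le> cosh u * exp (- u\<^sup>2 / 2)"
  proof (rule DERIV_nonpos_imp_nonincreasing[OF \<open>u \<le> v\<close>, of "\<lambda>x. cosh x * exp (- x\<^sup>2 / 2)"])
    fix x assume x: "u \<le> x" "x \<le> v"
    have le: "sinh x \<le> x * cosh x"
    proof -
      have "0 * cosh 0 - sinh 0 \<le> x * cosh x - sinh x"
      proof (rule DERIV_nonneg_imp_nondecreasing[of 0 x "\<lambda>x. x * cosh x - sinh x"])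
        fix y assume "0 \<le> y" "y \<le> x"
        then show "\<exists>d. ((\<lambda>x. x * cosh x - sinh x) has_real_derivative d) (at y) \<and> 0 \<le> d"
          by (intro exI[of _ "y * sinh y"]) (auto intro!: derivative_eq_intros)
      qed (use x assms in auto)
      then show ?thesis by simp
    qed
    have "((\<lambda>x. cosh x * exp (- x\<^sup>2 / 2)) has_real_derivative (sinh x - x * cosh x) * exp (- x\<^sup>2 / 2)) (at x)"
      by (auto intro!: derivative_eq_intros simp: algebra_simps)
    moreover have "(sinh x - x * cosh x) * exp (- x\<^sup>2 / 2) \<le> 0"
      using le by (intro mult_nonpos_nonneg) auto
    ultimately show "\<exists>d. ((\<lambda>x. cosh x * exp (- x\<^sup>2 / 2)) has_real_derivative d) (at x) \<and> d \<le> 0"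
      by blast
  qed
  then have "cosh v * exp (- v\<^sup>2 / 2) * exp (v\<^sup>2 / 2) \<le> cosh u * exp (- u\<^sup>2 / 2) * exp (v\<^sup>2 / 2)"
    by (rule mult_right_mono) simp
  then show ?thesis
    by (simp add: mult.assoc flip: exp_add) (simp add: diff_divide_distrib mult.commute)
qed

text \<open>
  The graph of the convex function \<open>\<rho>\<^bsup>\<alpha>\<^esup>\<close> lies below its chord over \<open>[exp (- b), exp b]\<close>; the
  right-hand side is that chord.
\<close>
lemma powr_le_chord:
  fixes \<rho> b \<alpha> :: real
  assumes b: "0 < b" and \<alpha>: "1 \<le> \<alpha>" and \<rho>: "exp (- b) \<le> \<rho>" "\<rho> \<le> exp b"
  shows "\<rho> powr \<alpha> \<le> (sinh (\<alpha> * b) * \<rho> - sinh ((\<alpha> - 1) * b)) / sinh b"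
proof -
  define l where "l = (\<rho> - exp (- b)) / (exp b - exp (- b))"
  have d: "exp b - exp (- b) > 0" using b by simp
  have l: "0 \<le> l" "l \<le> 1" using \<rho> d by (auto simp: l_def)
  have eq: "(1 - l) * exp (- b) + l * exp b = \<rho>"
  proof -
    have "(1 - l) * exp (- b) + l * exp b = exp (- b) + l * (exp b - exp (- b))"
      by (simp add: algebra_simps)
    then show ?thesis using d by (simp add: l_def)
  qed
  have "\<rho> powr \<alpha> = ((1 - l) *\<^sub>R exp (- b) + l *\<^sub>R exp b) powr \<alpha>" by (simp add: eq)
  also have "\<dots> \<le> (1 - l) * exp (- b) powr \<alpha> + l * exp b powr \<alpha>"
    by (rule convex_onD[OF powr_convex[OF \<alpha>]]) (use l in auto)
  also have "\<dots> = (1 - l) * exp (- (\<alpha> * b)) + l * exp (\<alpha> * b)"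
    by (simp add: exp_powr_real mult.commute)
  also have "\<dots> = exp (- (\<alpha> * b)) + l * (2 * sinh (\<alpha> * b))"
    by (simp add: sinh_field_def field_simps)
  also have "\<dots> = (exp (- (\<alpha> * b)) * sinh b + (\<rho> - exp (- b)) * sinh (\<alpha> * b)) / sinh b"
  proof -
    have "exp b - exp (- b) = 2 * sinh b" by (simp add: sinh_field_def)
    then have l': "l = (\<rho> - exp (- b)) / (2 * sinh b)" by (simp add: l_def)
    show ?thesis unfolding l' using b by (simp add: field_simps)
  qed
  also have "exp (- (\<alpha> * b)) * sinh b + (\<rho> - exp (- b)) * sinh (\<alpha> * b)
     = sinh (\<alpha> * b) * \<rho> - sinh ((\<alpha> - 1) * b)"
    by (simp add: left_diff_distrib sinh_diff cosh_minus_sinh[symmetric] algebra_simps)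
  finally show ?thesis .
qed

text \<open>
  The left-hand side is the value at \<open>1\<close> of the chord above. By the addition theorems it equals
  \<open>cosh ((\<alpha> - 1 / 2) * b) / cosh (b / 2)\<close>, to which the growth bound for \<open>cosh\<close> applies.
\<close>
lemma sinh_diff_le_exp:
  fixes b \<alpha> :: real
  assumes b: "0 < b" and \<alpha>: "1 \<le> \<alpha>"
  shows "(sinh (\<alpha> * b) - sinh ((\<alpha> - 1) * b)) / sinh b \<le> exp ((\<alpha> - 1) * (b\<^sup>2 / 2 * \<alpha>))"
proof -
  define u where "u = b / 2"
  define v where "v = (2 * \<alpha> - 1) * u"
  have u: "b = 2 * u" "0 < u" "\<alpha> * b = v + u" "(\<alpha> - 1) * b = v - u"
    using b by (auto simp: u_def v_def algebra_simps)
  have "(sinh (v + u) - sinh (v - u)) / sinh (2 * u) = cosh v / cosh u"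
    using u(2) by (simp add: sinh_add sinh_diff sinh_double)
  also have "\<dots> \<le> exp ((v\<^sup>2 - u\<^sup>2) / 2)"
  proof -
    have "u * 1 \<le> u * (2 * \<alpha> - 1)" using u(2) \<alpha> by (intro mult_left_mono) auto
    then show ?thesis
      using cosh_le_exp_cosh[of u v] u(2) by (simp add: v_def divide_le_eq mult.commute)
  qed
  also have "(v\<^sup>2 - u\<^sup>2) / 2 = (\<alpha> - 1) * (b\<^sup>2 / 2 * \<alpha>)"
    by (simp add: u(1) v_def power2_eq_square field_simps)
  finally show ?thesis by (simp only: u(3,4) u(1)[symmetric])
qed

text \<open>
  A pure privacy loss of at most \<open>b\<close> costs only \<open>b\<^sup>2 / 2\<close> in concentrated divergence. The
  likelihood ratio \<open>q / r\<close> has mean \<open>1\<close> under \<open>r\<close>, so replacing \<open>(q / r)\<^bsup>\<alpha>\<^esup>\<close> by the chord of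
  \<open>\<rho>\<^bsup>\<alpha>\<^esup>\<close> bounds the moment by the value of that chord at \<open>1\<close>; in other words, the extremal
  ratio takes only the values \<open>exp b\<close> and \<open>exp (- b)\<close>.
\<close>
lemma renyi_integral_le_of_bounded_ratio:
  assumes [measurable]: "q \<in> borel_measurable N" "r \<in> borel_measurable N"
    and pos: "\<And>x. 0 < q x" "\<And>x. 0 < r x"
    and q1: "(\<integral>\<^sup>+x. ennreal (q x) \<partial>N) = 1" and r1: "(\<integral>\<^sup>+x. ennreal (r x) \<partial>N) = 1"
    and b: "0 < b" and ratio: "AE x in N. q x \<le> exp b * r x \<and> r x \<le> exp b * q x"
    and \<alpha>: "1 < \<alpha>"
  shows "renyi_integral \<alpha> N q r \<le> ennreal (exp ((\<alpha> - 1) * (b\<^sup>2 / 2 * \<alpha>)))"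
proof -
  define B where "B = sinh (\<alpha> * b) / sinh b"
  define A where "A = sinh ((\<alpha> - 1) * b) / sinh b"
  have AB: "0 \<le> A" "0 \<le> B" using b \<alpha> by (auto simp: A_def B_def)
  \<comment> \<open>The chord has a negative constant term \<open>- A\<close>, which is moved to the other side to stay within
      nonnegative extended reals.\<close>
  have "renyi_integral \<alpha> N q r + ennreal A
     = (\<integral>\<^sup>+x. ennreal (q x powr \<alpha> * r x powr (1 - \<alpha>)) + ennreal A * ennreal (r x) \<partial>N)"
    unfolding renyi_integral_def by (subst nn_integral_add) (auto simp: nn_integral_cmult r1)
  also have "\<dots> \<le> (\<integral>\<^sup>+x. ennreal B * ennreal (q x) \<partial>N)"
  proof (rule nn_integral_mono_AE, use ratio in eventually_elim)
    fix x assume x: "q x \<le> exp b * r x \<and> r x \<le> exp b * q x"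
    have "(q x / r x) powr \<alpha> \<le> (sinh (\<alpha> * b) * (q x / r x) - sinh ((\<alpha> - 1) * b)) / sinh b"
      using x b \<alpha> pos[of x] by (intro powr_le_chord) (auto simp: field_simps exp_minus)
    also have "\<dots> = B * (q x / r x) - A" by (simp add: A_def B_def diff_divide_distrib)
    finally have "(q x / r x) powr \<alpha> * r x \<le> (B * (q x / r x) - A) * r x"
      using pos(2)[of x] by (intro mult_right_mono) auto
    moreover have "(q x / r x) powr \<alpha> * r x = q x powr \<alpha> * r x powr (1 - \<alpha>)"
      using pos[of x] by (simp add: powr_divide powr_diff)
    moreover have "(B * (q x / r x) - A) * r x = B * q x - A * r x"
      using pos(2)[of x] by (simp add: field_simps)
    ultimately have "q x powr \<alpha> * r x powr (1 - \<alpha>) + A * r x \<le> B * q x" by simp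
    then show "ennreal (q x powr \<alpha> * r x powr (1 - \<alpha>)) + ennreal A * ennreal (r x) \<le> ennreal B * ennreal (q x)"
      using AB pos[of x] by (simp flip: ennreal_mult ennreal_plus add: ennreal_leI less_imp_le)
  qed
  also have "\<dots> = ennreal B" by (simp add: nn_integral_cmult q1)
  finally have le: "renyi_integral \<alpha> N q r + ennreal A \<le> ennreal B" .
  then have "renyi_integral \<alpha> N q r \<noteq> \<top>" by (auto simp: top_unique)
  then obtain I where I: "renyi_integral \<alpha> N q r = ennreal I" "0 \<le> I"
    by (cases "renyi_integral \<alpha> N q r") auto
  then have "I \<le> B - A" using le AB by (simp flip: ennreal_plus)
  also have "\<dots> \<le> exp ((\<alpha> - 1) * (b\<^sup>2 / 2 * \<alpha>))"
    using sinh_diff_le_exp[OF b, of \<alpha>] \<alpha> by (simp add: A_def B_def diff_divide_distrib)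
  finally show ?thesis by (simp add: I(1) ennreal_leI)
qed

section \<open>Mixtures and the Gaussian shift\<close>

text \<open>
  Data processing for a kernel with a density: if \<open>p\<close> and \<open>q\<close> arise by drawing \<open>w\<close> from \<open>a\<close> or
  from \<open>b\<close> and then \<open>x\<close> from \<open>k _ w\<close>, forgetting \<open>w\<close> cannot increase the divergence. The map
  \<open>(u, v) \<mapsto> u\<^bsup>\<alpha>\<^esup> v\<^bsup>1 - \<alpha>\<^esup>\<close> is convex and homogeneous, hence for fixed \<open>x\<close> its value at the
  mixtures \<open>(p x, q x)\<close> is at most the mixture of its values at \<open>(a w, b w)\<close>.
\<close>
lemma renyi_integral_mixture_le:
  fixes k :: "'x \<Rightarrow> 'w \<Rightarrow> real"
  assumes N: "sigma_finite_measure N" and L: "sigma_finite_measure L"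
    and k[measurable]: "(\<lambda>(x, w). k x w) \<in> borel_measurable (N \<Otimes>\<^sub>M L)"
    and ab[measurable]: "a \<in> borel_measurable L" "b \<in> borel_measurable L"
    and k0: "\<And>x w. 0 \<le> k x w" and pos: "\<And>w. 0 < a w" "\<And>w. 0 < b w" "\<And>x. 0 < p x" "\<And>x. 0 < q x"
    and k1: "\<And>w. (\<integral>\<^sup>+x. k x w \<partial>N) = 1"
    and p: "AE x in N. ennreal (p x) = (\<integral>\<^sup>+w. k x w * a w \<partial>L)"
    and q: "AE x in N. ennreal (q x) = (\<integral>\<^sup>+w. k x w * b w \<partial>L)"
    and \<alpha>: "1 < \<alpha>"
  shows "renyi_integral \<alpha> N p q \<le> renyi_integral \<alpha> L a b"
proof -
  interpret N: sigma_finite_measure N by (fact N)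
  interpret L: sigma_finite_measure L by (fact L)
  interpret pair_sigma_finite N L ..
  have "renyi_integral \<alpha> N p q \<le>
      (\<integral>\<^sup>+x. (\<integral>\<^sup>+w. ennreal (k x w * (a w powr \<alpha> * b w powr (1 - \<alpha>))) \<partial>L) \<partial>N)"
    unfolding renyi_integral_def
  proof (rule nn_integral_mono_AE, use p q AE_space in eventually_elim)
    fix x
    assume px: "ennreal (p x) = (\<integral>\<^sup>+w. k x w * a w \<partial>L)" and qx: "ennreal (q x) = (\<integral>\<^sup>+w. k x w * b w \<partial>L)"
      and [measurable]: "x \<in> space N"
    have [measurable]: "k x \<in> borel_measurable L" by measurable
    \<comment> \<open>The convexity is used through the tangent plane at the direction \<open>(p x, q x)\<close>, which avoids
        assuming that the integral of the values is finite.\<close>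
    define c where "c = p x / q x"
    have c: "0 < c" using pos by (simp add: c_def)
    have tangent: "\<alpha> * c powr (\<alpha> - 1) * a w \<le> a w powr \<alpha> * b w powr (1 - \<alpha>) + (\<alpha> - 1) * c powr \<alpha> * b w" for w
    proof -
      have "(a w powr \<alpha> * b w powr (1 - \<alpha>)) powr (1 / \<alpha>) * (c powr \<alpha> * b w) powr (1 - 1 / \<alpha>)
        \<le> 1 / \<alpha> * (a w powr \<alpha> * b w powr (1 - \<alpha>)) + (1 - 1 / \<alpha>) * (c powr \<alpha> * b w)"
        using \<alpha> c pos(1,2)[of w] less_imp_neq[OF pos(1), of w] less_imp_neq[OF pos(2), of w]
        by (intro Youngs_inequality_0) auto
      also have "(a w powr \<alpha> * b w powr (1 - \<alpha>)) powr (1 / \<alpha>) * (c powr \<alpha> * b w) powr (1 - 1 / \<alpha>)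
        = a w powr (\<alpha> * (1 / \<alpha>)) * b w powr ((1 - \<alpha>) * (1 / \<alpha>) + (1 - 1 / \<alpha>)) * c powr (\<alpha> * (1 - 1 / \<alpha>))"
        by (simp only: powr_mult powr_powr powr_add mult.assoc mult.commute mult.left_commute)
      also have "\<dots> = a w * c powr (\<alpha> - 1)"
        using \<alpha> pos(1,2)[of w] by (simp add: algebra_simps diff_divide_distrib)
      finally have "\<alpha> * (a w * c powr (\<alpha> - 1)) \<le> \<alpha> * (1 / \<alpha> * (a w powr \<alpha> * b w powr (1 - \<alpha>)) + (1 - 1 / \<alpha>) * (c powr \<alpha> * b w))"
        using \<alpha> by (intro mult_left_mono) auto
      then show ?thesis using \<alpha> by (simp add: algebra_simps)
    qed
    let ?I = "\<integral>\<^sup>+w. ennreal (k x w * (a w powr \<alpha> * b w powr (1 - \<alpha>))) \<partial>L"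
    have "ennreal (\<alpha> * c powr (\<alpha> - 1)) * ennreal (p x) = (\<integral>\<^sup>+w. ennreal (\<alpha> * c powr (\<alpha> - 1)) * ennreal (k x w * a w) \<partial>L)"
      unfolding px by (rule nn_integral_cmult[symmetric]) measurable
    also have "\<dots> \<le> (\<integral>\<^sup>+w. ennreal (k x w * (a w powr \<alpha> * b w powr (1 - \<alpha>)))
        + ennreal ((\<alpha> - 1) * c powr \<alpha>) * ennreal (k x w * b w) \<partial>L)"
    proof (rule nn_integral_mono)
      fix w
      have "k x w * (\<alpha> * c powr (\<alpha> - 1) * a w) \<le> k x w * (a w powr \<alpha> * b w powr (1 - \<alpha>) + (\<alpha> - 1) * c powr \<alpha> * b w)"
        by (intro mult_left_mono tangent k0)
      then have "ennreal (\<alpha> * c powr (\<alpha> - 1) * (k x w * a w)) \<le>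
          ennreal (k x w * (a w powr \<alpha> * b w powr (1 - \<alpha>)) + (\<alpha> - 1) * c powr \<alpha> * (k x w * b w))"
        by (intro ennreal_leI) (simp add: algebra_simps)
      then show "ennreal (\<alpha> * c powr (\<alpha> - 1)) * ennreal (k x w * a w)
        \<le> ennreal (k x w * (a w powr \<alpha> * b w powr (1 - \<alpha>))) + ennreal ((\<alpha> - 1) * c powr \<alpha>) * ennreal (k x w * b w)"
        using k0[of x w] pos(1,2)[of w] \<alpha> by (simp add: ennreal_mult)
    qed
    also have "\<dots> = ?I + ennreal ((\<alpha> - 1) * c powr \<alpha>) * ennreal (q x)"
      unfolding qx by (subst nn_integral_add) (auto simp: nn_integral_cmult)
    finally have le: "ennreal (\<alpha> * c powr (\<alpha> - 1)) * ennreal (p x) \<le> ?I + ennreal ((\<alpha> - 1) * c powr \<alpha>) * ennreal (q x)" .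
    have 1: "\<alpha> * c powr (\<alpha> - 1) * p x = \<alpha> * (p x powr \<alpha> * q x powr (1 - \<alpha>))"
      and 2: "(\<alpha> - 1) * c powr \<alpha> * q x = (\<alpha> - 1) * (p x powr \<alpha> * q x powr (1 - \<alpha>))"
      using pos(3,4)[of x] by (simp_all add: c_def powr_divide powr_diff field_simps)
    define e where "e = p x powr \<alpha> * q x powr (1 - \<alpha>)"
    have e: "0 \<le> e" by (simp add: e_def)
    have "ennreal (\<alpha> * e) \<le> ?I + ennreal ((\<alpha> - 1) * e)"
      using le \<alpha> pos(3,4)[of x] 1 2 unfolding e_def[symmetric] by (simp flip: ennreal_mult add: less_imp_le)
    moreover have "ennreal (\<alpha> * e) = ennreal e + ennreal ((\<alpha> - 1) * e)"
    proof -
      have "\<alpha> * e = e + (\<alpha> - 1) * e" by (simp add: algebra_simps)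
      then show ?thesis using e \<alpha> by (simp only:) (intro ennreal_plus, auto)
    qed
    ultimately show "ennreal (p x powr \<alpha> * q x powr (1 - \<alpha>)) \<le> ?I"
      unfolding e_def[symmetric] by (simp add: ennreal_add_left_cancel_le add.commute)
  qed
  also have "\<dots> = (\<integral>\<^sup>+w. (\<integral>\<^sup>+x. ennreal (k x w * (a w powr \<alpha> * b w powr (1 - \<alpha>))) \<partial>N) \<partial>L)"
    by (rule Fubini'[symmetric]) measurable
  also have "\<dots> = renyi_integral \<alpha> L a b"
    unfolding renyi_integral_def
  proof (rule nn_integral_cong)
    fix w assume [measurable]: "w \<in> space L"
    have [measurable]: "(\<lambda>x. k x w) \<in> borel_measurable N" by measurable
    have "(\<integral>\<^sup>+x. ennreal (k x w * (a w powr \<alpha> * b w powr (1 - \<alpha>))) \<partial>N)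
       = (\<integral>\<^sup>+x. ennreal (k x w) * ennreal (a w powr \<alpha> * b w powr (1 - \<alpha>)) \<partial>N)"
      by (intro nn_integral_cong ennreal_mult k0) auto
    also have "\<dots> = ennreal (a w powr \<alpha> * b w powr (1 - \<alpha>))"
      by (subst nn_integral_multc) (auto simp: k1)
    finally show "(\<integral>\<^sup>+x. ennreal (k x w * (a w powr \<alpha> * b w powr (1 - \<alpha>))) \<partial>N)
      = ennreal (a w powr \<alpha> * b w powr (1 - \<alpha>))" .
  qed
  finally show ?thesis .
qed

text \<open>
  Completing the square turns the integrand into a multiple of the normal density with mean
  \<open>(1 - \<alpha>) * t\<close>.
\<close>
lemma renyi_integral_normal_shift:
  assumes \<sigma>: "0 < \<sigma>"
  shows "renyi_integral \<alpha> lborel (normal_density 0 \<sigma>) (normal_density t \<sigma>)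
    = ennreal (exp ((\<alpha> - 1) * ((t / \<sigma>)\<^sup>2 / 2 * \<alpha>)))"
proof -
  let ?C = "exp ((\<alpha> - 1) * ((t / \<sigma>)\<^sup>2 / 2 * \<alpha>))"
  have "normal_density 0 \<sigma> x powr \<alpha> * normal_density t \<sigma> x powr (1 - \<alpha>) = ?C * normal_density ((1 - \<alpha>) * t) \<sigma> x" for x
  proof -
    define d where "d = 1 / sqrt (2 * pi * \<sigma>\<^sup>2)"
    have d: "0 < d" using \<sigma> by (simp add: d_def)
    have "normal_density 0 \<sigma> x powr \<alpha> * normal_density t \<sigma> x powr (1 - \<alpha>)
      = (d powr \<alpha> * d powr (1 - \<alpha>)) * (exp (- x\<^sup>2 / (2 * \<sigma>\<^sup>2) * \<alpha>) * exp (- (x - t)\<^sup>2 / (2 * \<sigma>\<^sup>2) * (1 - \<alpha>)))"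
      by (simp add: normal_density_def d_def[symmetric] powr_mult exp_powr_real)
    also have "d powr \<alpha> * d powr (1 - \<alpha>) = d" using d by (simp flip: powr_add)
    also have "exp (- x\<^sup>2 / (2 * \<sigma>\<^sup>2) * \<alpha>) * exp (- (x - t)\<^sup>2 / (2 * \<sigma>\<^sup>2) * (1 - \<alpha>))
      = exp ((\<alpha> - 1) * ((t / \<sigma>)\<^sup>2 / 2 * \<alpha>) + - (x - (1 - \<alpha>) * t)\<^sup>2 / (2 * \<sigma>\<^sup>2))"
      unfolding exp_add[symmetric] using \<sigma> by (simp add: field_simps power2_eq_square)
    finally show ?thesis
      unfolding normal_density_def exp_add d_def[symmetric] by (simp only: ac_simps)
  qed
  then have "renyi_integral \<alpha> lborel (normal_density 0 \<sigma>) (normal_density t \<sigma>)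
    = (\<integral>\<^sup>+x. ennreal ?C * ennreal (normal_density ((1 - \<alpha>) * t) \<sigma> x) \<partial>lborel)"
    unfolding renyi_integral_def by (simp add: ennreal_mult)
  also have "\<dots> = ennreal ?C * (\<integral>\<^sup>+x. normal_density ((1 - \<alpha>) * t) \<sigma> x \<partial>lborel)"
    by (rule nn_integral_cmult) measurable
  also have "(\<integral>\<^sup>+x. normal_density ((1 - \<alpha>) * t) \<sigma> x \<partial>lborel) = 1"
    using \<sigma> by (subst nn_integral_eq_integral) auto
  finally show ?thesis by simp
qed

section \<open>The Gaussian tail\<close>

definition normal_tail :: "real \<Rightarrow> real" where
  "normal_tail v = measure std_normal_distribution {v<..}"

lemma ennreal_normal_tail:
  "ennreal (normal_tail v) = (\<integral>\<^sup>+y. ennreal (std_normal_density y) * indicator {v<..} y \<partial>lborel)"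
proof -
  interpret prob_space std_normal_distribution
    by (rule prob_space_normal_density) simp
  have "ennreal (normal_tail v) = emeasure std_normal_distribution {v<..}"
    by (simp add: normal_tail_def emeasure_eq_measure)
  then show ?thesis by (simp add: emeasure_density)
qed

lemma normal_tail_eq_cdf: "normal_tail v = 1 - cdf std_normal_distribution v"
proof -
  interpret prob_space std_normal_distribution
    by (rule prob_space_normal_density) simp
  have "{v<..} = space std_normal_distribution - {..v}" by auto
  then show ?thesis unfolding normal_tail_def cdf_def by (subst prob_compl[symmetric]) auto
qed

lemma has_real_derivative_normal_tail:
  "(normal_tail has_real_derivative - std_normal_density v) (at v)"
proof -
  interpret real_distribution std_normal_distribution by (rule real_dist_normal_dist)
  have cdf: "normal_tail u = normal_tail (v - 1) - (LBINT y=v - 1..u. std_normal_density y)" if "v - 1 < u" for u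
  proof -
    have "cdf std_normal_distribution u - cdf std_normal_distribution (v - 1)
       = measure std_normal_distribution {v - 1<..u}"
      using that by (rule cdf_diff_eq)
    also have "\<dots> = (\<integral>y. indicator {v - 1<..u} y \<partial>std_normal_distribution)"
      by simp
    also have "\<dots> = (LBINT y:{v - 1<..u}. std_normal_density y)"
      by (subst integral_density) (auto simp: set_lebesgue_integral_def mult.commute)
    also have "\<dots> = (LBINT y=v - 1..u. std_normal_density y)"
      using that by (simp add: interval_integral_Ioc)
    finally show ?thesis by (simp add: normal_tail_eq_cdf)
  qed
  have "((\<lambda>u. LBINT y=v - 1..u. std_normal_density y) has_vector_derivative std_normal_density v)
      (at v within {v - 1..v + 1})"
    by (rule interval_integral_FTC2) (auto simp: normal_density_def intro!: continuous_intros)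
  then have "((\<lambda>u. LBINT y=v - 1..u. std_normal_density y) has_real_derivative std_normal_density v) (at v)"
    by (simp add: has_real_derivative_iff_has_vector_derivative at_within_Icc_at)
  then have "((\<lambda>u. normal_tail (v - 1) - (LBINT y=v - 1..u. std_normal_density y))
      has_real_derivative - std_normal_density v) (at v)"
    by (auto intro!: derivative_eq_intros)
  then show ?thesis
    by (rule has_field_derivative_transform_within_open[of _ _ _ "{v - 1<..}"]) (auto simp: cdf)
qed

lemma normal_tail_antimono: "v \<le> w \<Longrightarrow> normal_tail w \<le> normal_tail v"
  unfolding normal_tail_def
  by (intro finite_measure.finite_measure_mono prob_space.finite_measure prob_space_normal_density) auto

lemma normal_tail_0: "normal_tail 0 = 1 / 2"
proof -
  have "ennreal 1 = (\<integral>\<^sup>+y. ennreal (std_normal_density y) \<partial>lborel)"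
    by (subst nn_integral_eq_integral) auto
  also have "\<dots> = (\<integral>\<^sup>+y. ennreal (std_normal_density y) * indicator {0<..} y
      + ennreal (std_normal_density y) * indicator {..<0} y \<partial>lborel)"
    by (intro nn_integral_cong_AE eventually_mono[OF AE_lborel_singleton[of 0]])
      (auto split: split_indicator)
  also have "\<dots> = ennreal (normal_tail 0) + (\<integral>\<^sup>+y. ennreal (std_normal_density y) * indicator {..<0} y \<partial>lborel)"
    unfolding ennreal_normal_tail by (rule nn_integral_add) auto
  also have "(\<integral>\<^sup>+y. ennreal (std_normal_density y) * indicator {..<0} y \<partial>lborel) = ennreal (normal_tail 0)"
    unfolding ennreal_normal_tail
    by (subst nn_integral_real_affine[where c = "-1" and t = 0])
      (auto simp: std_normal_density_def intro!: nn_integral_cong split: split_indicator)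
  finally have "ennreal 1 = ennreal (normal_tail 0 + normal_tail 0)"
    by (simp only: ennreal_plus normal_tail_def measure_nonneg)
  moreover have "0 \<le> normal_tail 0" by (simp add: normal_tail_def)
  ultimately show ?thesis
    using ennreal_inj[of 1 "normal_tail 0 + normal_tail 0"] by (simp del: ennreal_plus ennreal_1)
qed

text \<open>
  The density is decreasing on the nonnegative reals, so the area over \<open>[v, v + c]\<close> contains a
  rectangle of this height.
\<close>
lemma normal_tail_ge_rectangle:
  assumes "0 \<le> v" "0 \<le> c"
  shows "c * std_normal_density (v + c) \<le> normal_tail v"
proof -
  have "ennreal (c * std_normal_density (v + c)) = (\<integral>\<^sup>+y. ennreal (std_normal_density (v + c)) * indicator {v<..v + c} y \<partial>lborel)"
    using assms by (simp add: nn_integral_cmult_indicator ennreal_mult mult.commute)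
  also have "\<dots> \<le> ennreal (normal_tail v)"
    unfolding ennreal_normal_tail
    using assms
    by (intro nn_integral_mono)
      (auto split: split_indicator simp: std_normal_density_def intro!: ennreal_leI divide_right_mono power_mono)
  finally show ?thesis by (simp add: normal_tail_def)
qed

lemma normal_tail_pos: "0 < normal_tail v"
proof -
  have "0 < std_normal_density (max v 0 + 1)" by (simp add: normal_density_pos)
  also have "\<dots> \<le> normal_tail (max v 0)" using normal_tail_ge_rectangle[of "max v 0" 1] by simp
  also have "\<dots> \<le> normal_tail v" by (rule normal_tail_antimono) simp
  finally show ?thesis .
qed

text \<open>
  For \<open>v \<le> 0\<close> the factor \<open>2 * normal_tail v\<close> is at least \<open>1\<close>. For \<open>v \<ge> 0\<close> the rectangle of width
  \<open>\<sigma>\<close> suffices as soon as \<open>2 * std_normal_density 0 * \<sigma> \<ge> 1\<close>, that is \<open>\<sigma>\<^sup>2 \<ge> pi / 2\<close>; this is where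
  the lower bound on \<open>\<sigma>\<close> enters.
\<close>
lemma std_normal_density_le_normal_tail:
  assumes \<sigma>: "sqrt 2 \<le> \<sigma>"
  shows "std_normal_density (v + \<sigma>) \<le> 2 * std_normal_density 0 * normal_tail v"
proof (cases "0 \<le> v")
  case True
  have "1 \<le> 2 * std_normal_density 0 * \<sigma>"
  proof -
    have "sqrt (pi * 2) \<le> sqrt (4 * 2)" using pi_less_4 by (intro real_sqrt_le_mono) auto
    also have "\<dots> = 2 * sqrt 2" unfolding real_sqrt_mult by simp
    also have "\<dots> \<le> 2 * \<sigma>" using \<sigma> by simp
    finally show ?thesis by (simp add: std_normal_density_def field_simps)
  qed
  then have "1 * std_normal_density (v + \<sigma>) \<le> (2 * std_normal_density 0 * \<sigma>) * std_normal_density (v + \<sigma>)"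
    by (rule mult_right_mono) simp
  also have "\<dots> = 2 * std_normal_density 0 * (\<sigma> * std_normal_density (v + \<sigma>))" by simp
  also have "\<dots> \<le> 2 * std_normal_density 0 * normal_tail v"
    using normal_tail_ge_rectangle[OF True, of \<sigma>] order_trans[OF real_sqrt_ge_zero[of 2] \<sigma>]
    by (intro mult_left_mono) auto
  finally show ?thesis by simp
next
  case False
  have "std_normal_density (v + \<sigma>) \<le> std_normal_density 0"
    by (simp add: std_normal_density_def field_simps)
  also have "\<dots> = 2 * std_normal_density 0 * normal_tail 0" by (simp add: normal_tail_0)
  also have "\<dots> \<le> 2 * std_normal_density 0 * normal_tail v"
    using False by (intro mult_left_mono normal_tail_antimono) auto
  finally show ?thesis .
qed

section \<open>The density of the uniform log-normal distribution\<close>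

text \<open>
  The density at \<open>x\<close> of the uniform distribution on \<open>[- exp w, exp w]\<close>. Parametrising by the
  logarithm \<open>w\<close> of the scale makes ULN the mixture of these distributions over a normal \<open>w\<close>, and
  turns a rescaling of ULN into a shift of that normal.
\<close>
definition uniform_kernel :: "real \<Rightarrow> real \<Rightarrow> real" where
  "uniform_kernel x w = exp (- w) / 2 * indicator {- exp w..exp w} x"

lemma uniform_kernel_measurable[measurable]:
  assumes [measurable]: "f \<in> borel_measurable N" "g \<in> borel_measurable N"
  shows "(\<lambda>z. uniform_kernel (f z) (g z)) \<in> borel_measurable N"
proof -
  have "(\<lambda>z. uniform_kernel (f z) (g z))
      = (\<lambda>z. exp (- g z) / 2 * (if - exp (g z) \<le> f z \<and> f z \<le> exp (g z) then 1 else 0))"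
    by (auto simp: uniform_kernel_def fun_eq_iff)
  also have "\<dots> \<in> borel_measurable N" by measurable
  finally show ?thesis .
qed

lemma uniform_kernel_nonneg: "0 \<le> uniform_kernel x w"
  by (simp add: uniform_kernel_def)

lemma nn_integral_uniform_kernel: "(\<integral>\<^sup>+x. uniform_kernel x w \<partial>lborel) = 1"
proof -
  have "(\<integral>\<^sup>+x. uniform_kernel x w \<partial>lborel) = (\<integral>\<^sup>+x. ennreal (exp (- w) / 2) * indicator {- exp w..exp w} x \<partial>lborel)"
    by (intro nn_integral_cong) (auto simp: uniform_kernel_def split: split_indicator)
  also have "\<dots> = 1"
    by (simp add: nn_integral_cmult_indicator exp_minus flip: ennreal_mult)
  finally show ?thesis .
qed

lemma uniform_kernel_scale: "uniform_kernel x (t + w) = exp (- t) * uniform_kernel (exp (- t) * x) w"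
proof -
  have "- exp (t + w) \<le> x \<longleftrightarrow> - exp w \<le> exp (- t) * x" "x \<le> exp (t + w) \<longleftrightarrow> exp (- t) * x \<le> exp w"
    by (simp_all add: exp_add exp_minus field_simps)
  then show ?thesis by (auto simp: uniform_kernel_def exp_add exp_diff exp_minus field_simps split: split_indicator)
qed

text \<open>
  At \<open>x = 0\<close> the convention \<open>ln 0 = 0\<close> yields a value that does not extend the density
  continuously; at this single point it only matters that the value is positive.
\<close>
definition uln_density :: "real \<Rightarrow> real \<Rightarrow> real" where
  "uln_density \<sigma> x = exp (\<sigma>\<^sup>2 / 2) / 2 * normal_tail ((ln \<bar>x\<bar> + \<sigma>\<^sup>2) / \<sigma>)"

lemma normal_tail_measurable[measurable]: "normal_tail \<in> borel_measurable borel"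
proof -
  have "isCont normal_tail v" for v
    using has_real_derivative_normal_tail by (rule DERIV_isCont)
  then show ?thesis by (intro borel_measurable_continuous_onI) (auto simp: continuous_on_eq_continuous_at)
qed

lemma uln_density_measurable[measurable]: "uln_density \<sigma> \<in> borel_measurable borel"
  unfolding uln_density_def by measurable

lemma uln_density_pos: "0 < uln_density \<sigma> x"
  by (simp add: uln_density_def normal_tail_pos)

text \<open>
  The point \<open>x\<close> is hit only by scales with \<open>w \<ge> ln \<bar>x\<bar>\<close>, and the factor \<open>exp (- w)\<close> tilts the normal
  density of \<open>w\<close> to one with mean \<open>- \<sigma>\<^sup>2\<close>; so the mixture is a Gaussian tail.
\<close>
lemma uln_density_mixture:
  assumes \<sigma>: "0 < \<sigma>" and x: "x \<noteq> 0"
  shows "ennreal (uln_density \<sigma> x) = (\<integral>\<^sup>+w. uniform_kernel x w * normal_density 0 \<sigma> w \<partial>lborel)"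
proof -
  let ?v = "(ln \<bar>x\<bar> + \<sigma>\<^sup>2) / \<sigma>"
  have "(\<integral>\<^sup>+w. uniform_kernel x w * normal_density 0 \<sigma> w \<partial>lborel)
     = ennreal \<sigma> * (\<integral>\<^sup>+y. uniform_kernel x (- \<sigma>\<^sup>2 + \<sigma> * y) * normal_density 0 \<sigma> (- \<sigma>\<^sup>2 + \<sigma> * y) \<partial>lborel)"
    using \<sigma> by (subst nn_integral_real_affine[where c = \<sigma> and t = "- \<sigma>\<^sup>2"]) auto
  also have "\<dots> = (\<integral>\<^sup>+y. ennreal \<sigma> * ennreal (uniform_kernel x (- \<sigma>\<^sup>2 + \<sigma> * y) * normal_density 0 \<sigma> (- \<sigma>\<^sup>2 + \<sigma> * y)) \<partial>lborel)"
    by (rule nn_integral_cmult[symmetric]) measurable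
  \<comment> \<open>The substitution \<open>w = - \<sigma>\<^sup>2 + \<sigma> y\<close> standardises the tilted normal distribution.\<close>
  also have "\<dots> = (\<integral>\<^sup>+y. ennreal (exp (\<sigma>\<^sup>2 / 2) / 2) * (ennreal (std_normal_density y) * indicator {?v<..} y) \<partial>lborel)"
  proof (intro nn_integral_cong_AE eventually_mono[OF AE_lborel_singleton[of ?v]])
    fix y assume y: "y \<noteq> ?v"
    have "x \<in> {- exp (- \<sigma>\<^sup>2 + \<sigma> * y)..exp (- \<sigma>\<^sup>2 + \<sigma> * y)} \<longleftrightarrow> ln \<bar>x\<bar> \<le> - \<sigma>\<^sup>2 + \<sigma> * y"
      using x ln_le_cancel_iff[of "\<bar>x\<bar>" "exp (- \<sigma>\<^sup>2 + \<sigma> * y)"] by (auto simp: abs_le_iff)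
    also have "\<dots> \<longleftrightarrow> y \<in> {?v<..}"
      using \<sigma> y by (auto simp: field_simps)
    finally have ind: "indicator {- exp (- \<sigma>\<^sup>2 + \<sigma> * y)..exp (- \<sigma>\<^sup>2 + \<sigma> * y)} x = (indicator {?v<..} y :: real)"
      by (simp add: indicator_def)
    have sq: "sqrt (2 * pi * \<sigma>\<^sup>2) = sqrt (2 * pi) * \<sigma>" using \<sigma> by (simp add: real_sqrt_mult)
    have e: "exp (- (- \<sigma>\<^sup>2 + \<sigma> * y)) * exp (- (- \<sigma>\<^sup>2 + \<sigma> * y - 0)\<^sup>2 / (2 * \<sigma>\<^sup>2)) = exp (\<sigma>\<^sup>2 / 2) * exp (- y\<^sup>2 / 2)"
      using \<sigma> by (simp flip: exp_add) (simp add: field_simps power2_eq_square)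
    have "\<sigma> * (uniform_kernel x (- \<sigma>\<^sup>2 + \<sigma> * y) * normal_density 0 \<sigma> (- \<sigma>\<^sup>2 + \<sigma> * y))
       = (exp (- (- \<sigma>\<^sup>2 + \<sigma> * y)) * exp (- (- \<sigma>\<^sup>2 + \<sigma> * y - 0)\<^sup>2 / (2 * \<sigma>\<^sup>2))) / 2 / sqrt (2 * pi) * indicator {?v<..} y"
      using \<sigma> unfolding uniform_kernel_def ind normal_density_def sq by simp
    also have "\<dots> = exp (\<sigma>\<^sup>2 / 2) / 2 * (std_normal_density y * indicator {?v<..} y)"
      unfolding e std_normal_density_def by simp
    finally show "ennreal \<sigma> * ennreal (uniform_kernel x (- \<sigma>\<^sup>2 + \<sigma> * y) * normal_density 0 \<sigma> (- \<sigma>\<^sup>2 + \<sigma> * y))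
       = ennreal (exp (\<sigma>\<^sup>2 / 2) / 2) * (ennreal (std_normal_density y) * indicator {?v<..} y)"
      using \<sigma> by (simp flip: ennreal_mult ennreal_indicator add: uniform_kernel_nonneg)
  qed
  also have "\<dots> = ennreal (exp (\<sigma>\<^sup>2 / 2) / 2) * ennreal (normal_tail ?v)"
    unfolding ennreal_normal_tail by (rule nn_integral_cmult) measurable
  also have "\<dots> = ennreal (uln_density \<sigma> x)"
    unfolding uln_density_def by (rule ennreal_mult[symmetric]) (simp_all add: normal_tail_pos less_imp_le)
  finally show ?thesis by simp
qed

lemma scaled_uln_density_mixture:
  assumes \<sigma>: "0 < \<sigma>" and x: "x \<noteq> 0"
  shows "ennreal (exp (- t) * uln_density \<sigma> (exp (- t) * x))
    = (\<integral>\<^sup>+w. uniform_kernel x w * normal_density t \<sigma> w \<partial>lborel)"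
proof -
  have "ennreal (exp (- t) * uln_density \<sigma> (exp (- t) * x))
     = ennreal (exp (- t)) * (\<integral>\<^sup>+w. uniform_kernel (exp (- t) * x) w * normal_density 0 \<sigma> w \<partial>lborel)"
    using x by (simp add: ennreal_mult uln_density_pos less_imp_le uln_density_mixture[OF \<sigma>])
  also have "\<dots> = (\<integral>\<^sup>+w. ennreal (exp (- t)) * ennreal (uniform_kernel (exp (- t) * x) w * normal_density 0 \<sigma> w) \<partial>lborel)"
    by (rule nn_integral_cmult[symmetric]) measurable
  also have "\<dots> = (\<integral>\<^sup>+w. uniform_kernel x (t + 1 * w) * normal_density t \<sigma> (t + 1 * w) \<partial>lborel)"
    by (intro nn_integral_cong) (simp add: uniform_kernel_scale normal_density_def uniform_kernel_nonneg flip: ennreal_mult)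
  also have "\<dots> = (\<integral>\<^sup>+w. uniform_kernel x w * normal_density t \<sigma> w \<partial>lborel)"
    by (subst (2) nn_integral_real_affine[where c = 1 and t = t]) auto
  finally show ?thesis .
qed

text \<open>
  Conditionally on the Gaussian variable the law is uniform on a symmetric interval; exchange the
  order of integration.
\<close>
lemma ULN_eq_density:
  assumes \<sigma>: "0 < \<sigma>"
  shows "ULN \<sigma> = density lborel (uln_density \<sigma>)"
proof (rule measure_eqI)
  fix A assume "A \<in> sets (ULN \<sigma>)"
  then have A[measurable]: "A \<in> sets borel" by (simp add: ULN_def)
  let ?U = "uniform_measure lborel {-1..1::real}"
  interpret U: prob_space ?U by (rule prob_space_uniform_measure) auto
  interpret Y: prob_space std_normal_distribution by (rule prob_space_normal_density) simp
  interpret UY: pair_sigma_finite ?U std_normal_distribution ..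
  have scale: "(\<integral>\<^sup>+u. indicator A (u * exp w) \<partial>?U) = (\<integral>\<^sup>+x. indicator A x * ennreal (uniform_kernel x w) \<partial>lborel)" for w
  proof -
    have "(\<integral>\<^sup>+x. indicator A x * ennreal (uniform_kernel x w) \<partial>lborel)
       = ennreal (exp w) * (\<integral>\<^sup>+u. indicator A (exp w * u) * ennreal (uniform_kernel (exp w * u) w) \<partial>lborel)"
      by (subst nn_integral_real_affine[where c = "exp w" and t = 0]) auto
    also have "\<dots> = (\<integral>\<^sup>+u. ennreal (exp w) * (indicator A (exp w * u) * ennreal (uniform_kernel (exp w * u) w)) \<partial>lborel)"
      by (rule nn_integral_cmult[symmetric]) measurable
    also have "\<dots> = (\<integral>\<^sup>+u. ennreal (1 / 2) * (indicator A (u * exp w) * indicator {-1..1} u) \<partial>lborel)"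
    proof (intro nn_integral_cong)
      fix u :: real
      have "- exp w \<le> exp w * u \<longleftrightarrow> - 1 \<le> u" "exp w * u \<le> exp w \<longleftrightarrow> u \<le> 1"
        using mult_le_cancel_left_pos[of "exp w" "-1" u] by auto
      then have "exp w * uniform_kernel (exp w * u) w = 1 / 2 * indicator {-1..1} u"
        by (auto simp: uniform_kernel_def exp_minus split: split_indicator)
      then have "ennreal (exp w * uniform_kernel (exp w * u) w) = ennreal (1 / 2 * indicator {-1..1} u)"
        by (rule arg_cong)
      then have "ennreal (exp w) * ennreal (uniform_kernel (exp w * u) w) = ennreal (1 / 2) * indicator {-1..1} u"
        by (simp only: ennreal_mult' exp_ge_zero ennreal_indicator)
      then show "ennreal (exp w) * (indicator A (exp w * u) * ennreal (uniform_kernel (exp w * u) w))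
         = ennreal (1 / 2) * (indicator A (u * exp w) * indicator {-1..1} u)"
        by (simp only: mult.left_commute[of "ennreal (exp w)"] mult.left_commute[of "ennreal (1 / 2)"]
            mult.commute[of u])
    qed
    also have "\<dots> = ennreal (1 / 2) * (\<integral>\<^sup>+u. indicator A (u * exp w) * indicator {-1..1} u \<partial>lborel)"
      by (rule nn_integral_cmult) measurable
    also have "\<dots> = (\<integral>\<^sup>+u. indicator A (u * exp w) \<partial>?U)"
      by (subst nn_integral_uniform_measure) (auto simp: divide_ennreal_def mult.commute)
    finally show ?thesis by simp
  qed
  have "emeasure (ULN \<sigma>) A
     = (\<integral>\<^sup>+z. indicator A z \<partial>distr (?U \<Otimes>\<^sub>M std_normal_distribution) borel (\<lambda>(u, y). u * exp (\<sigma> * y)))"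
    by (simp add: ULN_def)
  also have "\<dots> = (\<integral>\<^sup>+z. indicator A (fst z * exp (\<sigma> * snd z)) \<partial>(?U \<Otimes>\<^sub>M std_normal_distribution))"
    by (subst nn_integral_distr) (auto simp: case_prod_beta)
  also have "\<dots> = (\<integral>\<^sup>+y. (\<integral>\<^sup>+u. indicator A (u * exp (\<sigma> * y)) \<partial>?U) \<partial>std_normal_distribution)"
    by (subst UY.nn_integral_snd[symmetric]) auto
  also have "\<dots> = (\<integral>\<^sup>+y. (\<integral>\<^sup>+x. indicator A x * ennreal (uniform_kernel x (\<sigma> * y)) \<partial>lborel) \<partial>std_normal_distribution)"
    by (simp add: scale)
  also have "\<dots> = (\<integral>\<^sup>+y. (\<integral>\<^sup>+x. indicator A x * ennreal (uniform_kernel x (\<sigma> * y) * std_normal_density y) \<partial>lborel) \<partial>lborel)"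
    by (subst nn_integral_density)
      (auto simp: nn_integral_cmult[symmetric] uniform_kernel_nonneg ennreal_mult ac_simps intro!: nn_integral_cong)
  also have "\<dots> = (\<integral>\<^sup>+x. (\<integral>\<^sup>+y. indicator A x * ennreal (uniform_kernel x (\<sigma> * y) * std_normal_density y) \<partial>lborel) \<partial>lborel)"
    by (rule lborel_pair.Fubini') measurable
  also have "\<dots> = (\<integral>\<^sup>+x. indicator A x * ennreal (uln_density \<sigma> x) \<partial>lborel)"
  proof (intro nn_integral_cong_AE eventually_mono[OF AE_lborel_singleton[of 0]])
    fix x :: real assume x: "x \<noteq> 0"
    have "(\<integral>\<^sup>+y. indicator A x * ennreal (uniform_kernel x (\<sigma> * y) * std_normal_density y) \<partial>lborel)
       = indicator A x * (\<integral>\<^sup>+y. ennreal \<sigma> * ennreal (uniform_kernel x (0 + \<sigma> * y) * normal_density 0 \<sigma> (0 + \<sigma> * y)) \<partial>lborel)"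
      using \<sigma> by (subst nn_integral_cmult)
        (auto intro!: nn_integral_cong arg_cong2[of _ _ _ _ "(*)"] simp: normal_density_def real_sqrt_mult power_mult_distrib uniform_kernel_nonneg simp flip: ennreal_mult)
    also have "\<dots> = indicator A x * (ennreal \<sigma> * (\<integral>\<^sup>+y. uniform_kernel x (0 + \<sigma> * y) * normal_density 0 \<sigma> (0 + \<sigma> * y) \<partial>lborel))"
      by (subst nn_integral_cmult) auto
    also have "\<dots> = indicator A x * (\<integral>\<^sup>+w. uniform_kernel x w * normal_density 0 \<sigma> w \<partial>lborel)"
      using \<sigma> by (subst (2) nn_integral_real_affine[where c = \<sigma> and t = 0]) auto
    also have "\<dots> = indicator A x * ennreal (uln_density \<sigma> x)"
      unfolding uln_density_mixture[OF \<sigma> x] ..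
    finally show "(\<integral>\<^sup>+y. indicator A x * ennreal (uniform_kernel x (\<sigma> * y) * std_normal_density y) \<partial>lborel)
       = indicator A x * ennreal (uln_density \<sigma> x)" .
  qed
  also have "\<dots> = emeasure (density lborel (uln_density \<sigma>)) A"
    by (subst emeasure_density) (auto simp: mult.commute)
  finally show "emeasure (ULN \<sigma>) A = emeasure (density lborel (uln_density \<sigma>)) A" .
qed (simp add: ULN_def)

lemma nn_integral_uln_density:
  assumes \<sigma>: "0 < \<sigma>"
  shows "(\<integral>\<^sup>+x. uln_density \<sigma> x \<partial>lborel) = 1"
proof -
  interpret U: prob_space "uniform_measure lborel {-1..1::real}" by (rule prob_space_uniform_measure) auto
  interpret Y: prob_space std_normal_distribution by (rule prob_space_normal_density) simp
  interpret UY: pair_prob_space "uniform_measure lborel {-1..1::real}" std_normal_distribution ..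
  have "prob_space (ULN \<sigma>)"
    unfolding ULN_def by (rule UY.prob_space_distr) measurable
  then have "emeasure (density lborel (uln_density \<sigma>)) UNIV = 1"
    unfolding ULN_eq_density[OF \<sigma>] using prob_space.emeasure_space_1 by fastforce
  then show ?thesis by (simp add: emeasure_density)
qed

lemma uln_density_abs: "uln_density \<sigma> x = uln_density \<sigma> \<bar>x\<bar>"
  by (simp add: uln_density_def)

lemma uln_density_antimono:
  assumes "0 < \<sigma>" "0 < x" "x \<le> y"
  shows "uln_density \<sigma> y \<le> uln_density \<sigma> x"
  unfolding uln_density_def using assms
  by (intro mult_left_mono normal_tail_antimono divide_right_mono) auto

text \<open>
  The logarithmic derivative of the density is at least \<open>- K\<close> on the positive half-line, so
  \<open>exp (K * x) * uln_density \<sigma> x\<close> is increasing there. With \<open>v = (ln x + \<sigma>\<^sup>2) / \<sigma>\<close>, minus this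
  logarithmic derivative is \<open>std_normal_density v / (\<sigma> * x * normal_tail v)\<close>; writing \<open>x\<close> in terms of \<open>v\<close>
  turns \<open>std_normal_density v / x\<close> into \<open>exp (3 * \<sigma>\<^sup>2 / 2) * std_normal_density (v + \<sigma>)\<close>, and the tail
  estimate above gives \<open>K\<close>.
\<close>
lemma uln_density_ratio_pos:
  assumes \<sigma>: "sqrt 2 \<le> \<sigma>" and xy: "0 < x" "x \<le> y"
  defines "K \<equiv> exp (3 * \<sigma>\<^sup>2 / 2) * sqrt (2 / (pi * \<sigma>\<^sup>2))"
  shows "uln_density \<sigma> x \<le> exp (K * (y - x)) * uln_density \<sigma> y"
proof -
  have \<sigma>0: "0 < \<sigma>" using \<sigma> by (meson less_le_trans real_sqrt_gt_zero zero_less_numeral)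
  have K: "K = exp (3 * \<sigma>\<^sup>2 / 2) * (2 * std_normal_density 0) / \<sigma>"
  proof -
    have "sqrt (2 / (pi * \<sigma>\<^sup>2)) = sqrt (4 / (2 * pi)) / \<sigma>"
      using \<sigma>0 by (simp add: real_sqrt_divide real_sqrt_mult)
    also have "sqrt (4 / (2 * pi)) = 2 * std_normal_density 0"
      unfolding std_normal_density_def real_sqrt_divide by simp
    finally show ?thesis by (simp add: K_def)
  qed
  have "exp (K * x) * uln_density \<sigma> x \<le> exp (K * y) * uln_density \<sigma> y"
  proof (rule DERIV_nonneg_imp_nondecreasing[OF xy(2), of "\<lambda>x. exp (K * x) * uln_density \<sigma> x"])
    fix u assume "x \<le> u" "u \<le> y"
    then have u: "0 < u" using xy by simp
    define v where "v = (ln u + \<sigma>\<^sup>2) / \<sigma>"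
    have uv: "u = exp (\<sigma> * v - \<sigma>\<^sup>2)" using u \<sigma>0 by (simp add: v_def)
    have "(uln_density \<sigma> has_real_derivative exp (\<sigma>\<^sup>2 / 2) / 2 * (- std_normal_density v * (1 / u / \<sigma>))) (at u)"
    proof (rule has_field_derivative_transform_within_open[of _ _ _ "{0<..}"])
      show "((\<lambda>x. exp (\<sigma>\<^sup>2 / 2) / 2 * normal_tail ((ln x + \<sigma>\<^sup>2) / \<sigma>)) has_real_derivative
          exp (\<sigma>\<^sup>2 / 2) / 2 * (- std_normal_density v * (1 / u / \<sigma>))) (at u)"
        using u \<sigma>0 unfolding v_def
        by (intro DERIV_cmult DERIV_chain2[OF has_real_derivative_normal_tail])
          (auto intro!: derivative_eq_intros)
    qed (use u in \<open>auto simp: uln_density_def\<close>)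
    then have "((\<lambda>x. exp (K * x) * uln_density \<sigma> x) has_real_derivative
        exp (K * u) * (K * uln_density \<sigma> u - exp (\<sigma>\<^sup>2 / 2) / 2 * (std_normal_density v * (1 / u / \<sigma>)))) (at u)"
      by (auto intro!: derivative_eq_intros simp: algebra_simps)
    moreover have "exp (\<sigma>\<^sup>2 / 2) / 2 * (std_normal_density v * (1 / u / \<sigma>)) \<le> K * uln_density \<sigma> u"
    proof -
      have "std_normal_density v / u = exp (3 * \<sigma>\<^sup>2 / 2) * std_normal_density (v + \<sigma>)"
        unfolding uv std_normal_density_def divide_inverse exp_minus[symmetric] mult.assoc
        by (simp add: mult.left_commute flip: exp_add) (simp add: power2_eq_square field_simps)
      also have "\<dots> \<le> exp (3 * \<sigma>\<^sup>2 / 2) * (2 * std_normal_density 0 * normal_tail v)"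
        by (intro mult_left_mono std_normal_density_le_normal_tail \<sigma>) simp
      finally have "exp (\<sigma>\<^sup>2 / 2) / 2 / \<sigma> * (std_normal_density v / u)
         \<le> exp (\<sigma>\<^sup>2 / 2) / 2 / \<sigma> * (exp (3 * \<sigma>\<^sup>2 / 2) * (2 * std_normal_density 0 * normal_tail v))"
        using \<sigma>0 by (intro mult_left_mono) auto
      then show ?thesis
        using u by (simp add: K uln_density_def v_def[symmetric] mult.commute mult.left_commute)
    qed
    ultimately show "\<exists>d. ((\<lambda>x. exp (K * x) * uln_density \<sigma> x) has_real_derivative d) (at u) \<and> 0 \<le> d"
      by (metis diff_ge_0_iff_ge exp_ge_zero mult_nonneg_nonneg)
  qed
  then have "exp (K * x) * uln_density \<sigma> x / exp (K * x) \<le> exp (K * y) * uln_density \<sigma> y / exp (K * x)"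
    by (rule divide_right_mono) simp
  then show ?thesis by (simp add: right_diff_distrib exp_diff)
qed

text \<open>
  Translating ULN by at most \<open>d\<close> changes its density by a factor of at most \<open>exp (K * d)\<close>, with \<open>K\<close>
  as above: only the absolute value of the argument matters, and the density decreases in it.
\<close>
lemma uln_density_ratio:
  assumes \<sigma>: "sqrt 2 \<le> \<sigma>" and "x \<noteq> 0" "y \<noteq> 0" and d: "\<bar>x - y\<bar> \<le> d"
  shows "uln_density \<sigma> x \<le> exp (exp (3 * \<sigma>\<^sup>2 / 2) * sqrt (2 / (pi * \<sigma>\<^sup>2)) * d) * uln_density \<sigma> y"
proof -
  let ?K = "exp (3 * \<sigma>\<^sup>2 / 2) * sqrt (2 / (pi * \<sigma>\<^sup>2))"
  have \<sigma>0: "0 < \<sigma>" using \<sigma> by (meson less_le_trans real_sqrt_gt_zero zero_less_numeral)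
  have K: "0 \<le> ?K" by simp
  have "uln_density \<sigma> \<bar>x\<bar> \<le> exp (?K * d) * uln_density \<sigma> \<bar>y\<bar>"
  proof (cases "\<bar>x\<bar> \<le> \<bar>y\<bar>")
    case True
    have "uln_density \<sigma> \<bar>x\<bar> \<le> exp (?K * (\<bar>y\<bar> - \<bar>x\<bar>)) * uln_density \<sigma> \<bar>y\<bar>"
      using assms True by (intro uln_density_ratio_pos) auto
    also have "\<dots> \<le> exp (?K * d) * uln_density \<sigma> \<bar>y\<bar>"
      using d K uln_density_pos[of \<sigma> "\<bar>y\<bar>"]
      by (intro mult_right_mono) (auto intro!: mult_left_mono simp del: mult_le_cancel_left_pos)
    finally show ?thesis .
  next
    case False
    then have "1 * uln_density \<sigma> \<bar>x\<bar> \<le> exp (?K * d) * uln_density \<sigma> \<bar>y\<bar>"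
      using assms \<sigma>0 K uln_density_pos[of \<sigma> "\<bar>x\<bar>"]
      by (intro mult_mono uln_density_antimono) (auto intro!: mult_nonneg_nonneg)
    then show ?thesis by simp
  qed
  then show ?thesis by (simp flip: uln_density_abs)
qed

section \<open>Divergence between affine images of ULN\<close>

lemma distr_affine_density:
  fixes g :: "real \<Rightarrow> real"
  assumes [measurable]: "g \<in> borel_measurable borel" and g0: "\<And>x. 0 \<le> g x" and c: "0 < c"
  shows "distr (density lborel g) borel (\<lambda>z. m + c * z) = density lborel (\<lambda>x. g ((x - m) / c) / c)"
proof (rule measure_eqI)
  fix A assume "A \<in> sets (distr (density lborel g) borel (\<lambda>z. m + c * z))"
  then have [measurable]: "A \<in> sets borel" by simp
  have "emeasure (density lborel (\<lambda>x. g ((x - m) / c) / c)) A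
     = (\<integral>\<^sup>+x. ennreal (g ((x - m) / c) / c) * indicator A x \<partial>lborel)"
    by (subst emeasure_density) auto
  also have "\<dots> = ennreal c * (\<integral>\<^sup>+z. ennreal (g z / c) * indicator A (m + c * z) \<partial>lborel)"
    using c by (subst nn_integral_real_affine[where c = c and t = m]) auto
  also have "\<dots> = (\<integral>\<^sup>+z. ennreal c * (ennreal (g z / c) * indicator A (m + c * z)) \<partial>lborel)"
    by (rule nn_integral_cmult[symmetric]) measurable
  also have "\<dots> = (\<integral>\<^sup>+z. ennreal (g z) * indicator A (m + c * z) \<partial>lborel)"
    using c g0 by (intro nn_integral_cong) (simp flip: mult.assoc ennreal_mult)
  also have "\<dots> = (\<integral>\<^sup>+z. indicator A (m + c * z) \<partial>density lborel g)"
    by (subst nn_integral_density) auto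
  also have "\<dots> = (\<integral>\<^sup>+x. indicator A x \<partial>distr (density lborel g) borel (\<lambda>z. m + c * z))"
    by (subst nn_integral_distr) auto
  finally show "emeasure (distr (density lborel g) borel (\<lambda>z. m + c * z)) A
     = emeasure (density lborel (\<lambda>x. g ((x - m) / c) / c)) A"
    by simp
qed simp

lemma renyi_integral_affine:
  fixes p q :: "real \<Rightarrow> real"
  assumes [measurable]: "p \<in> borel_measurable borel" "q \<in> borel_measurable borel"
    and c: "0 < c"
  shows "renyi_integral \<alpha> lborel (\<lambda>x. p ((x - m) / c) / c) (\<lambda>x. q ((x - m) / c) / c)
    = renyi_integral \<alpha> lborel p q"
proof -
  have "renyi_integral \<alpha> lborel (\<lambda>x. p ((x - m) / c) / c) (\<lambda>x. q ((x - m) / c) / c)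
     = ennreal c * (\<integral>\<^sup>+z. ennreal ((p z / c) powr \<alpha> * (q z / c) powr (1 - \<alpha>)) \<partial>lborel)"
    unfolding renyi_integral_def using c
    by (subst nn_integral_real_affine[where c = c and t = m]) auto
  also have "\<dots> = (\<integral>\<^sup>+z. ennreal c * ennreal ((p z / c) powr \<alpha> * (q z / c) powr (1 - \<alpha>)) \<partial>lborel)"
    by (rule nn_integral_cmult[symmetric]) measurable
  also have "\<dots> = renyi_integral \<alpha> lborel p q"
    unfolding renyi_integral_def
  proof (rule nn_integral_cong)
    fix z
    have "inverse c powr \<alpha> * inverse c powr (1 - \<alpha>) = inverse c"
      using c by (simp flip: powr_add)
    then have "c * ((p z / c) powr \<alpha> * (q z / c) powr (1 - \<alpha>)) = p z powr \<alpha> * q z powr (1 - \<alpha>)"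
      using c by (simp add: divide_inverse powr_mult mult.commute mult.left_commute)
    then show "ennreal c * ennreal ((p z / c) powr \<alpha> * (q z / c) powr (1 - \<alpha>))
       = ennreal (p z powr \<alpha> * q z powr (1 - \<alpha>))"
      using c by (simp flip: ennreal_mult)
  qed
  finally show ?thesis .
qed

text \<open>
  Multiplying ULN by \<open>exp \<tau>\<close> shifts the normal variable in its exponent by \<open>\<tau>\<close>, so the divergence is
  at most that of the shifted normal distributions.
\<close>
lemma renyi_integral_uln_scale:
  assumes \<sigma>: "0 < \<sigma>" and \<alpha>: "1 < \<alpha>"
  shows "renyi_integral \<alpha> lborel (uln_density \<sigma>) (\<lambda>x. exp (- \<tau>) * uln_density \<sigma> (exp (- \<tau>) * x))
    \<le> ennreal (exp ((\<alpha> - 1) * ((\<tau> / \<sigma>)\<^sup>2 / 2 * \<alpha>)))"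
proof -
  have "renyi_integral \<alpha> lborel (uln_density \<sigma>) (\<lambda>x. exp (- \<tau>) * uln_density \<sigma> (exp (- \<tau>) * x))
     \<le> renyi_integral \<alpha> lborel (normal_density 0 \<sigma>) (normal_density \<tau> \<sigma>)"
    using \<sigma> \<alpha>
    by (intro renyi_integral_mixture_le[where k = uniform_kernel])
      (auto simp: uniform_kernel_nonneg normal_density_pos uln_density_pos nn_integral_uniform_kernel
        uln_density_mixture scaled_uln_density_mixture sigma_finite_lborel
        intro!: eventually_mono[OF AE_lborel_singleton[of 0]])
  then show ?thesis using renyi_integral_normal_shift[OF \<sigma>] by simp
qed

text \<open>
  Change first the scale from \<open>c\<close> to \<open>c'\<close>, which costs \<open>t / \<sigma>\<close>, then the centre from \<open>m\<close> to \<open>m'\<close>,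
  which costs \<open>K * s\<close> with \<open>K\<close> the bound on the logarithmic derivative; the costs add by the triangle inequality.
\<close>
lemma renyi_divergence_affine_ULN:
  fixes s t \<sigma> :: real
  assumes \<sigma>: "sqrt 2 \<le> \<sigma>" and s: "0 < s" and t: "0 < t"
    and c: "0 < c" "0 < c'" "c \<le> exp t * c'" "c' \<le> exp t * c"
    and m: "\<bar>m - m'\<bar> \<le> s * c'" and \<alpha>: "1 < \<alpha>"
  defines "\<epsilon> \<equiv> t / \<sigma> + exp (3 * \<sigma>\<^sup>2 / 2) * sqrt (2 / (pi * \<sigma>\<^sup>2)) * s"
  shows "renyi_divergence \<alpha> (distr (ULN \<sigma>) borel (\<lambda>z. m + c * z)) (distr (ULN \<sigma>) borel (\<lambda>z. m' + c' * z))
    \<le> ereal (1 / 2 * \<epsilon>\<^sup>2 * \<alpha>)"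
proof -
  have \<sigma>0: "0 < \<sigma>" using \<sigma> by (meson less_le_trans real_sqrt_gt_zero zero_less_numeral)
  define g where "g = uln_density \<sigma>"
  have [measurable]: "g \<in> borel_measurable borel" and g: "\<And>x. 0 < g x" "\<And>x. 0 \<le> g x"
    by (auto simp: g_def uln_density_pos less_imp_le)
  define G where "G m c x = g ((x - m) / c) / c" for m c x
  have G_meas[measurable]: "G m c \<in> borel_measurable borel" for m c
    unfolding G_def by measurable
  have G_pos: "0 < c \<Longrightarrow> 0 < G m c x" for m c x by (simp add: G_def g)
  have distr: "distr (ULN \<sigma>) borel (\<lambda>z. m + c * z) = density lborel (G m c)" if "0 < c" for m c
    using that g unfolding ULN_eq_density[OF \<sigma>0] G_def g_def[symmetric] by (intro distr_affine_density) auto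
  have prob: "prob_space (density lborel (G m c))" if "0 < c" for m c
  proof -
    have "prob_space (density lborel g)"
      using nn_integral_uln_density[OF \<sigma>0] by (intro prob_spaceI) (simp add: emeasure_density g_def)
    then have "prob_space (distr (density lborel g) borel (\<lambda>z. m + c * z))"
      by (rule prob_space.prob_space_distr) simp
    then show ?thesis using that by (simp add: distr[OF that, symmetric] ULN_eq_density[OF \<sigma>0] g_def)
  qed
  have int1: "(\<integral>\<^sup>+x. G m c x \<partial>lborel) = 1" if "0 < c" for m c
    using prob_space.emeasure_space_1[OF prob[OF that, of m]] by (simp add: emeasure_density)
  define b where "b = exp (3 * \<sigma>\<^sup>2 / 2) * sqrt (2 / (pi * \<sigma>\<^sup>2)) * s"
  have b: "0 < b" using s \<sigma>0 by (simp add: b_def)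
  have scale: "renyi_integral \<beta> lborel (G m c) (G m c') \<le> ennreal (exp ((\<beta> - 1) * ((t / \<sigma>)\<^sup>2 / 2 * \<beta>)))"
    if \<beta>: "1 < \<beta>" for \<beta>
  proof -
    \<comment> \<open>The substitution \<open>x = m + c z\<close> reduces to the pair ULN and \<open>exp \<tau>\<close> times ULN.\<close>
    define \<tau> where "\<tau> = ln (c' / c)"
    have \<tau>: "exp (- \<tau>) = c / c'" using c by (simp add: \<tau>_def exp_minus)
    have "c' / c \<le> exp t" "exp (- t) \<le> c' / c" using c by (simp_all add: field_simps exp_minus)
    then have "ln (c' / c) \<le> ln (exp t)" "ln (exp (- t)) \<le> ln (c' / c)"
      using c by (simp_all only: ln_le_cancel_iff exp_gt_zero divide_pos_pos)
    then have "\<tau> \<le> t" "- t \<le> \<tau>" by (simp_all add: \<tau>_def)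
    then have "(\<tau> / \<sigma>)\<^sup>2 \<le> (t / \<sigma>)\<^sup>2"
      using t \<sigma>0 by (intro power2_le_iff_abs_le[THEN iffD2]) (auto simp: abs_le_iff divide_right_mono)
    have "G m c' = (\<lambda>x. (exp (- \<tau>) * g (exp (- \<tau>) * ((x - m) / c))) / c)"
      unfolding \<tau> G_def using c by auto
    then have "renyi_integral \<beta> lborel (G m c) (G m c')
       = renyi_integral \<beta> lborel g (\<lambda>x. exp (- \<tau>) * g (exp (- \<tau>) * x))"
      using renyi_integral_affine[OF _ _ c(1), of g "\<lambda>x. exp (- \<tau>) * g (exp (- \<tau>) * x)" \<beta> m]
      unfolding G_def[of m c, abs_def] by simp
    also have "\<dots> \<le> ennreal (exp ((\<beta> - 1) * ((\<tau> / \<sigma>)\<^sup>2 / 2 * \<beta>)))"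
      unfolding g_def by (rule renyi_integral_uln_scale[OF \<sigma>0 \<beta>])
    also have "\<dots> \<le> ennreal (exp ((\<beta> - 1) * ((t / \<sigma>)\<^sup>2 / 2 * \<beta>)))"
      using \<beta> \<open>(\<tau> / \<sigma>)\<^sup>2 \<le> (t / \<sigma>)\<^sup>2\<close>
      by (intro ennreal_leI exp_le_cancel_iff[THEN iffD2] mult_left_mono mult_right_mono divide_right_mono) auto
    finally show ?thesis .
  qed
  have shift: "renyi_integral \<beta> lborel (G m c') (G m' c') \<le> ennreal (exp ((\<beta> - 1) * (b\<^sup>2 / 2 * \<beta>)))"
    if \<beta>: "1 < \<beta>" for \<beta>
  proof (rule renyi_integral_le_of_bounded_ratio[OF _ _ _ _ _ _ b _ \<beta>])
    show "AE x in lborel. G m c' x \<le> exp b * G m' c' x \<and> G m' c' x \<le> exp b * G m c' x"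
      using AE_lborel_singleton[of m] AE_lborel_singleton[of m']
    proof eventually_elim
      fix x assume x: "x \<noteq> m" "x \<noteq> m'"
      have "\<bar>(x - m) / c' - (x - m') / c'\<bar> = \<bar>m - m'\<bar> / c'"
        using c by (simp add: abs_divide abs_minus_commute flip: diff_divide_distrib)
      also have "\<dots> \<le> s" using m c by (simp add: divide_le_eq)
      finally have d: "\<bar>(x - m) / c' - (x - m') / c'\<bar> \<le> s" .
      then have d': "\<bar>(x - m') / c' - (x - m) / c'\<bar> \<le> s" by (simp add: abs_minus_commute)
      have "g ((x - m) / c') \<le> exp b * g ((x - m') / c')" "g ((x - m') / c') \<le> exp b * g ((x - m) / c')"
        unfolding g_def b_def using x c by (auto intro!: uln_density_ratio \<sigma> d d')
      then show "G m c' x \<le> exp b * G m' c' x \<and> G m' c' x \<le> exp b * G m c' x"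
        using c by (simp add: G_def divide_right_mono)
    qed
  qed (auto simp: G_pos c int1)
  have "renyi_integral \<alpha> lborel (G m c) (G m' c') \<le> ennreal (exp ((\<alpha> - 1) * ((t / \<sigma> + b)\<^sup>2 / 2 * \<alpha>)))"
    by (rule renyi_integral_triangle[OF _ _ _ _ _ _ _ b scale shift \<alpha>]) (auto simp: G_pos c t \<sigma>0)
  then have "renyi_divergence \<alpha> (density lborel (G m c)) (density lborel (G m' c'))
      \<le> ereal ((t / \<sigma> + b)\<^sup>2 / 2 * \<alpha>)"
    using \<alpha> by (intro renyi_divergence_density_le) (auto simp: G_pos c prob)
  then show ?thesis by (simp add: distr c \<epsilon>_def b_def)
qed

section \<open>Smooth sensitivity of neighbouring data sets\<close>

lemma hamming_dist_self [simp]: "hamming_dist x x = 0"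
  by (simp add: hamming_dist_def)

lemma hamming_dist_commute: "length x = length y \<Longrightarrow> hamming_dist x y = hamming_dist y x"
  unfolding hamming_dist_def by (intro arg_cong[where f = card]) auto

lemma hamming_dist_triangle:
  assumes "length x = length y"
  shows "hamming_dist x z \<le> hamming_dist x y + hamming_dist y z"
proof -
  have "hamming_dist x z \<le> card ({i. i < length x \<and> x ! i \<noteq> y ! i} \<union> {i. i < length y \<and> y ! i \<noteq> z ! i})"
    unfolding hamming_dist_def using assms by (intro card_mono) auto
  also have "\<dots> \<le> hamming_dist x y + hamming_dist y z"
    unfolding hamming_dist_def by (rule card_Un_le)
  finally show ?thesis .
qed

lemma local_sensitivity_nonneg:
  assumes "x \<in> nlists n X"
  shows "0 \<le> local_sensitivity n X f x"
  unfolding local_sensitivity_def using assms by (intro SUP_upper2[of x]) auto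

lemma abs_diff_le_smooth_sensitivity:
  assumes x: "x \<in> nlists n X" and y: "y \<in> nlists n X" and "hamming_dist x y \<le> 1"
  shows "ereal \<bar>f y - f x\<bar> \<le> smooth_sensitivity n X f t x"
proof -
  have "ereal \<bar>f y - f x\<bar> \<le> local_sensitivity n X f x"
    unfolding local_sensitivity_def using assms by (intro SUP_upper) auto
  also have "\<dots> \<le> smooth_sensitivity n X f t x"
    unfolding smooth_sensitivity_def using x by (intro SUP_upper2[of x]) auto
  finally show ?thesis .
qed

text \<open>
  Moving the centre to a neighbour changes every distance by at most one, hence every discount
  factor by at most \<open>exp t\<close>.
\<close>
lemma smooth_sensitivity_neighbor_le:
  assumes x: "x \<in> nlists n X" and y: "y \<in> nlists n X" and xy: "hamming_dist x y \<le> 1" and t: "0 \<le> t"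
  shows "smooth_sensitivity n X f t x \<le> ereal (exp t) * smooth_sensitivity n X f t y"
  unfolding smooth_sensitivity_def[of n X f t x]
proof (rule SUP_least)
  fix z assume z: "z \<in> nlists n X"
  have "hamming_dist y z \<le> hamming_dist x z + 1"
    using hamming_dist_triangle[of y x z] hamming_dist_commute[of x y] x y xy by simp
  then have "t * real (hamming_dist y z) \<le> t * (real (hamming_dist x z) + 1)"
    using t by (intro mult_left_mono) auto
  then have "exp (- t * real (hamming_dist x z)) \<le> exp t * exp (- t * real (hamming_dist y z))"
    by (simp flip: exp_add add: algebra_simps)
  then have "ereal (exp (- t * real (hamming_dist x z))) * local_sensitivity n X f z
     \<le> ereal (exp t * exp (- t * real (hamming_dist y z))) * local_sensitivity n X f z"
    using local_sensitivity_nonneg[OF z] by (intro ereal_mult_right_mono) auto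
  also have "\<dots> = ereal (exp t) * (ereal (exp (- t * real (hamming_dist y z))) * local_sensitivity n X f z)"
    by (simp only: times_ereal.simps(1)[symmetric] mult.assoc)
  also have "\<dots> \<le> ereal (exp t) * smooth_sensitivity n X f t y"
    unfolding smooth_sensitivity_def using z by (intro ereal_mult_left_mono SUP_upper) auto
  finally show "ereal (exp (- t * real (hamming_dist x z))) * local_sensitivity n X f z
     \<le> ereal (exp t) * smooth_sensitivity n X f t y" .
qed

section \<open>Privacy of the mechanism\<close>

theorem proposition4:
  fixes X :: "'a set" and n :: nat and f :: "'a list \<Rightarrow> real"
    and s t \<sigma> :: real
    and \<Omega> :: "'w measure" and Z :: "'w \<Rightarrow> real"
  assumes "n \<ge> 1"
    and "s > 0" and "t > 0" and "\<sigma> \<ge> sqrt 2"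
    and "\<And>x. x \<in> nlists n X \<Longrightarrow> smooth_sensitivity n X f t x < \<infinity>"
    and "prob_space \<Omega>" and "Z \<in> borel_measurable \<Omega>" and "distr \<Omega> borel Z = ULN \<sigma>"
  defines "M \<equiv> \<lambda>x. distr \<Omega> borel
                    (\<lambda>\<omega>. f x + 1 / s * real_of_ereal (smooth_sensitivity n X f t x) * Z \<omega>)"
    and "\<epsilon> \<equiv> t / \<sigma> + exp (3 * \<sigma>\<^sup>2 / 2) * sqrt (2 / (pi * \<sigma>\<^sup>2)) * s"
  shows "CDP (1/2 * \<epsilon>\<^sup>2) n X M"
  unfolding CDP_def
proof (intro ballI impI allI)
  fix x y :: "'a list" and \<alpha> :: real
  assume x: "x \<in> nlists n X" and y: "y \<in> nlists n X" and xy: "hamming_dist x y \<le> 1" and \<alpha>: "1 < \<alpha>"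
  have yx: "hamming_dist y x \<le> 1" using xy hamming_dist_commute[of x y] x y by simp
  have [measurable]: "Z \<in> borel_measurable \<Omega>" by fact
  define S where "S z = real_of_ereal (smooth_sensitivity n X f t z)" for z
  have S: "smooth_sensitivity n X f t z = ereal (S z)" and S0: "0 \<le> S z" if "z \<in> nlists n X" for z
  proof -
    have "0 \<le> smooth_sensitivity n X f t z"
      using abs_diff_le_smooth_sensitivity[OF that that, of f t] by (simp flip: zero_ereal_def)
    then show "smooth_sensitivity n X f t z = ereal (S z)" "0 \<le> S z"
      using assms(5)[OF that] by (auto simp: S_def ereal_real real_of_ereal_pos)
  qed
  have Sx: "S x \<le> exp t * S y" and Sy: "S y \<le> exp t * S x" and fS: "\<bar>f x - f y\<bar> \<le> S y"
    using smooth_sensitivity_neighbor_le[OF x y xy, of t f] smooth_sensitivity_neighbor_le[OF y x yx, of t f]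
      abs_diff_le_smooth_sensitivity[OF y x yx, of f t] S[OF x] S[OF y] \<open>t > 0\<close> by auto
  have M: "M z = distr (ULN \<sigma>) borel (\<lambda>u. f z + S z / s * u)" for z
    unfolding M_def S_def \<open>distr \<Omega> borel Z = ULN \<sigma>\<close>[symmetric]
    by (subst distr_distr) (auto simp: comp_def)
  show "renyi_divergence \<alpha> (M x) (M y) \<le> ereal (1 / 2 * \<epsilon>\<^sup>2 * \<alpha>)"
  proof (cases "S y = 0")
    case True
    \<comment> \<open>If one smooth sensitivity vanishes then so does the other, and the values of \<open>f\<close> agree.\<close>
    then have "M x = M y" using Sx S0[OF x] fS by (simp add: M)
    moreover have "prob_space (M y)"
      unfolding M_def using \<open>prob_space \<Omega>\<close> by (rule prob_space.prob_space_distr) measurable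
    ultimately show ?thesis using \<alpha> by (simp add: renyi_divergence_self)
  next
    case False
    then have "0 < S y" using S0[OF y] by simp
    moreover from this have "0 < S x" using Sy by (metis S0 exp_gt_zero less_le mult_zero_right not_le x)
    ultimately show ?thesis
      unfolding M \<epsilon>_def using assms(2-4) Sx Sy fS \<alpha>
      by (intro renyi_divergence_affine_ULN) (auto simp: divide_right_mono)
  qed
qed

end
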